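(* Let $G$ be a countable infinite group and let $(X_i)_{i\in I}$ be a family of minimal locally compact $G$-spaces. Then the following conditions are equivalent: (i) $\mathscr{T}(G,X_i)=\mathscr{T}(G,X_j)$ for all $i,j\in I$. (ii) There exist a minimal locally compact $G$-space $Z$ and a (surjective) proper continuous $G$-map $\varphi_i\colon Z\to X_i$ for each $i\in I$. (iii) There exists $x_i\in X_i$ for each $i\in I$ such that $\mathrm{T}(G,X_i,x_i)=\mathrm{T}(G,X_j,x_j)$ for all $i,j\in I$.
   Context: A locally compact $G$-space is a locally compact Hausdorff space with an action of the discrete group $G$ by homeomorphisms; it is minimal if non-empty and every orbit is dense, and co-compact if there is a compact $K\subseteq X$ with $\bigcup_{g\in G}g.K=X$ (minimal ones are co-compact). A $G$-map is a $G$-equivariant map; a continuous map is proper if preimages of compact sets are compact. A pointed locally compact $G$-space is a pair $(X,x_0)$ with $x_0\in X$ and $G.x_0$ dense in $X$. For non-empty $A,B\subseteq G$ write $A\propto B$ if $A\subseteq FB=\bigcup_{g\in F}gB$ for some finite $F\subseteq G$, and $A\approx B$ if $A\propto B$ and $B\propto A$; $[A]$ is the $\approx$-class of $A$. Pointed type: put $\mathcal M(G,X,x_0)=\{B\subseteq G:\overline{B.x_0}\text{ is compact}\}$ and $\mathcal M_A=\{B\subseteq G: B\subseteq FA\text{ for some finite }F\subseteq G\}$. If $X$ is co-compact, there is a non-empty $A\subseteq G$, unique up to $\approx$, with $\mathcal M(G,X,x_0)=\mathcal M_A$, and $\mathrm{T}(G,X,x_0)=[A]$. Base point free type: a sequence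 $(A_n)$ of subsets of $G$ converges to $B\subseteq G$ ($A_n\to B$) if $1_{A_n}\to 1_B$ pointwise. Write $A\succsim B$ if there are a sequence $(g_n)$ in $G$ and $B'\subseteq G$ with $Ag_n\to B'$ and $B\approx B'$; write $A\sim B$ if $A\succsim B$ and $B\succsim A$ (an equivalence relation, coarser than $\approx$), and let $\langle A\rangle$ be the $\sim$-class of $A$. For a co-compact locally compact $G$-space $X$ with a dense orbit, $\mathscr{T}(G,X)=\langle A\rangle$, where $\mathrm{T}(G,X,x)=[A]$ for any $x\in X$ with $G.x$ dense (this is independent of the choice of such $x$). *)

theory Defs
  imports "HOL-Analysis.Analysis" "HOL-Algebra.Group_Action"
begin

section \<open>Locally compact spaces with an action of a discrete group\<close>

definition locally_compact_G_space ::
    "('g, 'm) monoid_scheme \<Rightarrow> 'x topology \<Rightarrow> ('g \<Rightarrow> 'x \<Rightarrow> 'x) \<Rightarrow> bool" where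
  "locally_compact_G_space G X \<phi> \<longleftrightarrow>
     locally_compact_space X \<and> Hausdorff_space X \<and>
     group_action G (topspace X) \<phi> \<and>
     (\<forall>g \<in> carrier G. homeomorphic_map X X (\<phi> g))"

definition dense_orbit ::
    "('g, 'm) monoid_scheme \<Rightarrow> 'x topology \<Rightarrow> ('g \<Rightarrow> 'x \<Rightarrow> 'x) \<Rightarrow> 'x \<Rightarrow> bool" where
  "dense_orbit G X \<phi> x \<longleftrightarrow> X closure_of (orbit G \<phi> x) = topspace X"

definition minimal_G_space ::
    "('g, 'm) monoid_scheme \<Rightarrow> 'x topology \<Rightarrow> ('g \<Rightarrow> 'x \<Rightarrow> 'x) \<Rightarrow> bool" where
  "minimal_G_space G X \<phi> \<longleftrightarrow>
     locally_compact_G_space G X \<phi> \<and> topspace X \<noteq> {} \<and>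
     (\<forall>x \<in> topspace X. dense_orbit G X \<phi> x)"

text \<open>The constant \<open>proper_map\<close> of the library means ``closed with compact fibres''; here
  properness is the condition that preimages of compact sets are compact.\<close>

definition proper_G_map ::
    "('g, 'm) monoid_scheme \<Rightarrow> 'z topology \<Rightarrow> ('g \<Rightarrow> 'z \<Rightarrow> 'z) \<Rightarrow>
     'x topology \<Rightarrow> ('g \<Rightarrow> 'x \<Rightarrow> 'x) \<Rightarrow> ('z \<Rightarrow> 'x) \<Rightarrow> bool" where
  "proper_G_map G Z \<psi> X \<phi> f \<longleftrightarrow>
     continuous_map Z X f \<and>
     (\<forall>K. compactin X K \<longrightarrow> compactin Z {z \<in> topspace Z. f z \<in> K}) \<and>
     (\<forall>g \<in> carrier G. \<forall>z \<in> topspace Z. f (\<psi> g z) = \<phi> g (f z))"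


section \<open>The type of a pointed space\<close>

definition left_finitely_covered ::
    "('g, 'm) monoid_scheme \<Rightarrow> 'g set \<Rightarrow> 'g set \<Rightarrow> bool" where
  "left_finitely_covered G A B \<longleftrightarrow> (\<exists>F. finite F \<and> F \<subseteq> carrier G \<and> A \<subseteq> F <#>\<^bsub>G\<^esub> B)"

definition left_equiv :: "('g, 'm) monoid_scheme \<Rightarrow> 'g set \<Rightarrow> 'g set \<Rightarrow> bool" where
  "left_equiv G A B \<longleftrightarrow> left_finitely_covered G A B \<and> left_finitely_covered G B A"

definition left_class :: "('g, 'm) monoid_scheme \<Rightarrow> 'g set \<Rightarrow> 'g set set" where
  "left_class G A = {B. B \<subseteq> carrier G \<and> B \<noteq> {} \<and> left_equiv G A B}"

definition rel_compact_sets ::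
    "('g, 'm) monoid_scheme \<Rightarrow> 'x topology \<Rightarrow> ('g \<Rightarrow> 'x \<Rightarrow> 'x) \<Rightarrow> 'x \<Rightarrow> 'g set set" where
  "rel_compact_sets G X \<phi> x\<^sub>0 =
     {B. B \<subseteq> carrier G \<and> compactin X (X closure_of ((\<lambda>g. \<phi> g x\<^sub>0) ` B))}"

definition covered_sets :: "('g, 'm) monoid_scheme \<Rightarrow> 'g set \<Rightarrow> 'g set set" where
  "covered_sets G A = {B. B \<subseteq> carrier G \<and> left_finitely_covered G B A}"

text \<open>Below, \<open>THE\<close> picks the class of the set \<open>A\<close> that is unique up to
  \<^const>\<open>left_equiv\<close>. The value is unspecified if no such \<open>A\<close> exists, which does not
  happen for co-compact (in particular minimal) spaces.\<close>

definition pointed_type ::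
    "('g, 'm) monoid_scheme \<Rightarrow> 'x topology \<Rightarrow> ('g \<Rightarrow> 'x \<Rightarrow> 'x) \<Rightarrow> 'x \<Rightarrow> 'g set set" where
  "pointed_type G X \<phi> x\<^sub>0 =
     (THE c. \<exists>A. A \<subseteq> carrier G \<and> A \<noteq> {} \<and>
        rel_compact_sets G X \<phi> x\<^sub>0 = covered_sets G A \<and> c = left_class G A)"


section \<open>The base point free type\<close>

definition sets_converge ::
    "('g, 'm) monoid_scheme \<Rightarrow> (nat \<Rightarrow> 'g set) \<Rightarrow> 'g set \<Rightarrow> bool" where
  "sets_converge G A B \<longleftrightarrow>
     (\<forall>h \<in> carrier G. (\<lambda>n. indicator (A n) h :: real) \<longlonglongrightarrow> indicator B h)"

definition limit_dominates :: "('g, 'm) monoid_scheme \<Rightarrow> 'g set \<Rightarrow> 'g set \<Rightarrow> bool" where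
  "limit_dominates G A B \<longleftrightarrow>
     (\<exists>(g :: nat \<Rightarrow> 'g) B'. range g \<subseteq> carrier G \<and> B' \<subseteq> carrier G \<and>
        sets_converge G (\<lambda>n. A #>\<^bsub>G\<^esub> g n) B' \<and> left_equiv G B B')"

definition limit_equiv :: "('g, 'm) monoid_scheme \<Rightarrow> 'g set \<Rightarrow> 'g set \<Rightarrow> bool" where
  "limit_equiv G A B \<longleftrightarrow> limit_dominates G A B \<and> limit_dominates G B A"

definition limit_class :: "('g, 'm) monoid_scheme \<Rightarrow> 'g set \<Rightarrow> 'g set set" where
  "limit_class G A = {B. B \<subseteq> carrier G \<and> B \<noteq> {} \<and> limit_equiv G A B}"

text \<open>The class below does not depend on the point \<open>x\<close> with dense orbit, nor on the
  representative \<open>A\<close>, provided the space is co-compact and has a dense orbit.\<close>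

definition space_type ::
    "('g, 'm) monoid_scheme \<Rightarrow> 'x topology \<Rightarrow> ('g \<Rightarrow> 'x \<Rightarrow> 'x) \<Rightarrow> 'g set set" where
  "space_type G X \<phi> =
     (THE c. \<exists>x A. x \<in> topspace X \<and> dense_orbit G X \<phi> x \<and>
        A \<subseteq> carrier G \<and> A \<noteq> {} \<and> pointed_type G X \<phi> x = left_class G A \<and>
        c = limit_class G A)"

end

theory Submission
  imports Defs "HOL-Complex_Analysis.Great_Picard"
begin

text \<open>For a compact \<open>K\<close> with non-empty interior in a minimal space, the pointed type at \<open>x\<close> is the
  class of the set of \<open>g\<close> with \<open>g.x \<in> K\<close>; since finitely many translates of the interior cover
  \<open>K\<close>, the sets belonging to two points are \<open>\<sim>\<close>-equivalent. Proper maps preserve pointed types, so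
  (ii) and (iii) imply (i). Given (i), a cluster point of the translates \<open>g\<^sub>n\<^sup>-\<^sup>1.y\<close>, for \<open>g\<^sub>n\<close> witnessing
  \<open>\<succsim>\<close>, has the prescribed pointed type, which is (iii). Given (iii), the orbit of \<open>(x\<^sub>i)\<close> in the
  product generates a co-compact locally compact space with proper projections; a minimal closed
  invariant subset of it, found by Zorn's lemma, is the required extension.\<close>

section \<open>Finite covers and limits of translates\<close>

text \<open>The spaces need not be metrizable and \<open>I\<close> may have any size, so points are
  reached through cluster points and finitely many open conditions; only subsets of the countable
  group are treated by sequences. The central device is a pair \<open>U \<subseteq> K\<close> with
  \<open>U\<close> open and non-empty and \<open>K\<close> compact. That a translate of a point lies
  in \<open>U\<close>, or lies outside the closed set \<open>K\<close>, persists for nearby points;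
  that it lies in \<open>K\<close> does not. A finite set moving every point of \<open>K\<close>
  into \<open>U\<close> repairs this, and the relation \<approx> absorbs it. Thus return sets of
  nearby points agree on a finite set of group elements up to a correction that is independent of
  that finite set. For the common extension the obstacle is properness: an orbit closure in a
  product need not project properly to its factors. Equality of the pointed types says that a set of
  group elements which keeps one coordinate relatively compact does so for all of them.\<close>

context group
begin

text \<open>Replacing \<open>F\<close> by its inverses turns a covering into the task of moving each
  \<open>a\<close> into \<open>B\<close>. This suits return sets, where \<open>f \<otimes> a\<close>
  acts on the base point as \<open>a\<close> followed by \<open>f\<close>.\<close>

lemma left_finitely_covered_iff:
  assumes "A \<subseteq> carrier G" "B \<subseteq> carrier G"
  shows "left_finitely_covered G A B \<longleftrightarrow>
    (\<exists>F. finite F \<and> F \<subseteq> carrier G \<and> (\<forall>a\<in>A. \<exists>f\<in>F. f \<otimes> a \<in> B))"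
proof
  assume "left_finitely_covered G A B"
  then obtain F where F: "finite F" "F \<subseteq> carrier G" "A \<subseteq> F <#> B"
    by (auto simp: left_finitely_covered_def)
  have "\<exists>f\<in>m_inv G ` F. f \<otimes> a \<in> B" if a: "a \<in> A" for a
  proof -
    obtain f b where "f \<in> F" "b \<in> B" "a = f \<otimes> b"
      using F(3) a by (auto simp: set_mult_def)
    then have "inv f \<otimes> a = b"
      using F(2) assms by (simp add: m_assoc[symmetric] subset_iff)
    then show ?thesis using \<open>b \<in> B\<close> \<open>f \<in> F\<close> by auto
  qed
  then show "\<exists>F. finite F \<and> F \<subseteq> carrier G \<and> (\<forall>a\<in>A. \<exists>f\<in>F. f \<otimes> a \<in> B)"
    using F by (intro exI[of _ "m_inv G ` F"]) auto
next
  assume "\<exists>F. finite F \<and> F \<subseteq> carrier G \<and> (\<forall>a\<in>A. \<exists>f\<in>F. f \<otimes> a \<in> B)"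
  then obtain F where F: "finite F" "F \<subseteq> carrier G" "\<And>a. a \<in> A \<Longrightarrow> \<exists>f\<in>F. f \<otimes> a \<in> B"
    by blast
  have "A \<subseteq> m_inv G ` F <#> B"
  proof
    fix a assume a: "a \<in> A"
    then obtain f where f: "f \<in> F" "f \<otimes> a \<in> B" using F(3) by blast
    moreover have "a = inv f \<otimes> (f \<otimes> a)"
      using f a F(2) assms by (simp add: inv_solve_left subset_iff)
    ultimately show "a \<in> m_inv G ` F <#> B" by (auto simp: set_mult_def)
  qed
  then show "left_finitely_covered G A B"
    unfolding left_finitely_covered_def using F by (intro exI[of _ "m_inv G ` F"]) auto
qed

lemma subset_imp_left_finitely_covered:
  assumes "A \<subseteq> B" "B \<subseteq> carrier G"
  shows "left_finitely_covered G A B"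
proof -
  have "\<forall>a\<in>A. \<exists>f\<in>{\<one>}. f \<otimes> a \<in> B" using assms by (auto simp: subset_iff)
  then show ?thesis
    using assms by (subst left_finitely_covered_iff) (auto intro!: exI[of _ "{\<one>}"])
qed

lemma left_finitely_covered_refl: "A \<subseteq> carrier G \<Longrightarrow> left_finitely_covered G A A"
  by (simp add: subset_imp_left_finitely_covered)

lemma left_finitely_covered_trans:
  assumes "left_finitely_covered G A B" "left_finitely_covered G B C"
    and sub: "A \<subseteq> carrier G" "B \<subseteq> carrier G" "C \<subseteq> carrier G"
  shows "left_finitely_covered G A C"
proof -
  obtain F where F: "finite F" "F \<subseteq> carrier G" "\<And>a. a \<in> A \<Longrightarrow> \<exists>f\<in>F. f \<otimes> a \<in> B"
    using assms left_finitely_covered_iff by meson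
  obtain H where H: "finite H" "H \<subseteq> carrier G" "\<And>b. b \<in> B \<Longrightarrow> \<exists>h\<in>H. h \<otimes> b \<in> C"
    using assms left_finitely_covered_iff by meson
  have "\<exists>k\<in>H <#> F. k \<otimes> a \<in> C" if a: "a \<in> A" for a
  proof -
    obtain f where f: "f \<in> F" "f \<otimes> a \<in> B" using F a by blast
    obtain h where h: "h \<in> H" "h \<otimes> (f \<otimes> a) \<in> C" using H f by blast
    have "h \<otimes> f \<otimes> a \<in> C"
      using h f a F(2) H(2) sub by (simp add: m_assoc subset_iff)
    then show ?thesis using f h by (auto simp: set_mult_def)
  qed
  moreover have "finite (H <#> F)" "H <#> F \<subseteq> carrier G"
    using F H by (auto simp: set_mult_def)
  ultimately show ?thesis using sub left_finitely_covered_iff by meson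
qed

lemma left_equiv_refl: "A \<subseteq> carrier G \<Longrightarrow> left_equiv G A A"
  by (simp add: left_equiv_def left_finitely_covered_refl)

lemma left_equiv_sym: "left_equiv G A B \<Longrightarrow> left_equiv G B A"
  by (auto simp: left_equiv_def)

lemma left_equiv_trans:
  "\<lbrakk>left_equiv G A B; left_equiv G B C; A \<subseteq> carrier G; B \<subseteq> carrier G; C \<subseteq> carrier G\<rbrakk>
    \<Longrightarrow> left_equiv G A C"
  unfolding left_equiv_def by (blast intro: left_finitely_covered_trans)

lemma left_class_eq_iff:
  assumes "A \<subseteq> carrier G" "B \<subseteq> carrier G" "B \<noteq> {}"
  shows "left_class G A = left_class G B \<longleftrightarrow> left_equiv G A B"
proof
  assume "left_class G A = left_class G B"
  moreover have "B \<in> left_class G B"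
    using assms by (simp add: left_class_def left_equiv_refl)
  ultimately show "left_equiv G A B" by (auto simp: left_class_def)
next
  assume "left_equiv G A B"
  then show "left_class G A = left_class G B"
    unfolding left_class_def using assms by (blast intro: left_equiv_trans left_equiv_sym)
qed

text \<open>Each set belongs to its own family, so the family determines the class. This gives the
  uniqueness behind the \<open>THE\<close> in \<open>pointed_type\<close> and lets families stand in
  for classes later.\<close>

lemma covered_sets_eq_iff:
  assumes "A \<subseteq> carrier G" "B \<subseteq> carrier G"
  shows "covered_sets G A = covered_sets G B \<longleftrightarrow> left_equiv G A B"
proof
  assume "covered_sets G A = covered_sets G B"
  moreover have "A \<in> covered_sets G A" "B \<in> covered_sets G B"
    using assms by (simp_all add: covered_sets_def left_finitely_covered_refl)
  ultimately show "left_equiv G A B" by (auto simp: covered_sets_def left_equiv_def)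
next
  assume "left_equiv G A B"
  then show "covered_sets G A = covered_sets G B"
    unfolding covered_sets_def left_equiv_def using assms
    by (blast intro: left_finitely_covered_trans)
qed

lemma r_coset_iff:
  assumes "A \<subseteq> carrier G" "g \<in> carrier G" "h \<in> carrier G"
  shows "h \<in> A #> g \<longleftrightarrow> h \<otimes> inv g \<in> A"
proof
  assume "h \<in> A #> g"
  then obtain a where "a \<in> A" "h = a \<otimes> g" by (auto simp: r_coset_def)
  then show "h \<otimes> inv g \<in> A" using assms by (simp add: m_assoc subset_iff)
next
  assume "h \<otimes> inv g \<in> A"
  moreover have "h = h \<otimes> inv g \<otimes> g" using assms by (simp add: m_assoc)
  ultimately show "h \<in> A #> g" by (auto simp: r_coset_def)
qed

end

section \<open>Pointwise convergence of sets of group elements\<close>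

lemma sets_converge_iff:
  "sets_converge G A B \<longleftrightarrow> (\<forall>h\<in>carrier G. \<forall>\<^sub>F n in sequentially. h \<in> A n \<longleftrightarrow> h \<in> B)"
proof -
  have "((\<lambda>n. indicator (A n) h :: real) \<longlonglongrightarrow> indicator B h) \<longleftrightarrow>
      (\<forall>\<^sub>F n in sequentially. h \<in> A n \<longleftrightarrow> h \<in> B)" for h
  proof
    assume "(\<lambda>n. indicator (A n) h :: real) \<longlonglongrightarrow> indicator B h"
    \<comment> \<open>Indicator values are 0 or 1, so a distance below 1 forces them to
      agree.\<close>
    then have "\<forall>\<^sub>F n in sequentially. dist (indicator (A n) h :: real) (indicator B h) < 1"
      by (rule tendstoD) simp
    then show "\<forall>\<^sub>F n in sequentially. h \<in> A n \<longleftrightarrow> h \<in> B"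
      by eventually_elim (auto simp: indicator_def dist_real_def split: if_splits)
  next
    assume "\<forall>\<^sub>F n in sequentially. h \<in> A n \<longleftrightarrow> h \<in> B"
    then show "(\<lambda>n. indicator (A n) h :: real) \<longlonglongrightarrow> indicator B h"
      by (intro tendsto_eventually) (auto simp: indicator_def elim!: eventually_mono)
  qed
  then show ?thesis by (simp add: sets_converge_def)
qed

text \<open>Indicators are bounded by 1, so diagonal selection over the countable carrier gives a
  subsequence converging at every element. Since {0, 1} is closed, the limit is again an
  indicator.\<close>

lemma sets_converge_subsequence:
  assumes "countable (carrier G)"
  obtains k B where "strict_mono (k :: nat \<Rightarrow> nat)" "B \<subseteq> carrier G" "sets_converge G (A \<circ> k) B"
proof -
  obtain k where k: "strict_mono (k :: nat \<Rightarrow> nat)"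
    and lim: "\<And>h. h \<in> carrier G \<Longrightarrow> \<exists>l. (\<lambda>n. indicator (A (k n)) h :: real) \<longlonglongrightarrow> l"
  proof (rule function_convergent_subsequence[OF assms, of "\<lambda>n h. indicator (A n) h :: real" 1])
    show "norm (indicator (A n) h :: real) \<le> 1" for n h
      by (simp add: indicator_def)
  qed blast
  define B where "B = {h \<in> carrier G. (\<lambda>n. indicator (A (k n)) h :: real) \<longlonglongrightarrow> 1}"
  have "\<forall>\<^sub>F n in sequentially. h \<in> A (k n) \<longleftrightarrow> h \<in> B" if h: "h \<in> carrier G" for h
  proof -
    obtain l where l: "(\<lambda>n. indicator (A (k n)) h :: real) \<longlonglongrightarrow> l" using lim h by blast
    have "l \<in> {0, 1}"
      by (rule closed_sequentially[OF _ _ l]) (auto simp: indicator_def)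
    then consider "l = 0" | "l = 1" by blast
    then have "l = indicator B h"
    proof cases
      case 1
      then have "h \<notin> B" using LIMSEQ_unique[OF l] by (force simp: B_def)
      with 1 show ?thesis by simp
    next
      case 2
      then show ?thesis using l h by (simp add: B_def)
    qed
    then have "\<forall>\<^sub>F n in sequentially. dist (indicator (A (k n)) h :: real) (indicator B h) < 1"
      using tendstoD[OF l, of 1] by simp
    then show ?thesis
      by eventually_elim (auto simp: indicator_def dist_real_def split: if_splits)
  qed
  then have "sets_converge G (A \<circ> k) B"
    by (simp add: sets_converge_iff)
  moreover have "B \<subseteq> carrier G" by (auto simp: B_def)
  ultimately show thesis using k that by blast
qed

text \<open>A finitary form of \<^const>\<open>limit_dominates\<close>, equivalent to it for countable groups because
  the space of subsets of the group is then sequentially compact. It makes transitivity elementary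
  and can be checked for return sets by approximating one point by translates of another. The
  translating element \<open>g\<close> and the elements of \<open>F\<close> are the inverses of those in the original.\<close>

definition finitely_dominates :: "('g, 'm) monoid_scheme \<Rightarrow> 'g set \<Rightarrow> 'g set \<Rightarrow> bool" where
  "finitely_dominates G A B \<longleftrightarrow>
     (\<exists>F. finite F \<and> F \<subseteq> carrier G \<and>
        (\<forall>S. finite S \<and> S \<subseteq> carrier G \<longrightarrow>
           (\<exists>g\<in>carrier G.
              (\<forall>b\<in>B \<inter> S. \<exists>f\<in>F. f \<otimes>\<^bsub>G\<^esub> b \<otimes>\<^bsub>G\<^esub> g \<in> A) \<and>
              (\<forall>h\<in>S. h \<otimes>\<^bsub>G\<^esub> g \<in> A \<longrightarrow> (\<exists>f\<in>F. f \<otimes>\<^bsub>G\<^esub> h \<in> B)))))"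

lemma finitely_dominatesE:
  fixes G (structure)
  assumes "finitely_dominates G A B"
  obtains F where "finite F" "F \<subseteq> carrier G"
    "\<forall>S. finite S \<and> S \<subseteq> carrier G \<longrightarrow>
      (\<exists>g\<in>carrier G. (\<forall>b\<in>B \<inter> S. \<exists>f\<in>F. f \<otimes> b \<otimes> g \<in> A) \<and>
        (\<forall>h\<in>S. h \<otimes> g \<in> A \<longrightarrow> (\<exists>f\<in>F. f \<otimes> h \<in> B)))"
  using assms unfolding finitely_dominates_def by (elim exE conjE) (rule that)

section \<open>Equivalence of the sequential and the finitary domination\<close>

context group
begin

text \<open>The trivial translate \<open>g = \<one>\<close> serves every \<open>S\<close>. The sets
  \<open>F\<close> and \<open>H\<close> of the two coverings are joined because a single finite set
  has to serve both clauses.\<close>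

lemma left_equiv_imp_finitely_dominates:
  assumes "left_equiv G A B" "A \<subseteq> carrier G" "B \<subseteq> carrier G"
  shows "finitely_dominates G A B"
proof -
  obtain F where F: "finite F" "F \<subseteq> carrier G" "\<And>a. a \<in> A \<Longrightarrow> \<exists>f\<in>F. f \<otimes> a \<in> B"
    using assms left_finitely_covered_iff unfolding left_equiv_def by meson
  obtain H where H: "finite H" "H \<subseteq> carrier G" "\<And>b. b \<in> B \<Longrightarrow> \<exists>h\<in>H. h \<otimes> b \<in> A"
    using assms left_finitely_covered_iff unfolding left_equiv_def by meson
  have "(\<forall>b\<in>B \<inter> S. \<exists>f\<in>F \<union> H. f \<otimes> b \<otimes> \<one> \<in> A) \<and>
        (\<forall>h\<in>S. h \<otimes> \<one> \<in> A \<longrightarrow> (\<exists>f\<in>F \<union> H. f \<otimes> h \<in> B))" if S: "S \<subseteq> carrier G" for S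
  proof (intro conjI ballI impI)
    fix b assume b: "b \<in> B \<inter> S"
    then obtain h where "h \<in> H" "h \<otimes> b \<in> A" using H by blast
    then show "\<exists>f\<in>F \<union> H. f \<otimes> b \<otimes> \<one> \<in> A"
      using assms b by (intro bexI[of _ h]) (auto simp: subset_iff)
  next
    fix h assume "h \<in> S" "h \<otimes> \<one> \<in> A"
    then show "\<exists>f\<in>F \<union> H. f \<otimes> h \<in> B" using S F(3)[of h] by (auto simp: subset_iff)
  qed
  then show ?thesis
    unfolding finitely_dominates_def using F(1,2) H(1,2) by (intro exI[of _ "F \<union> H"]) blast
qed

text \<open>Given \<open>S\<close>, an element \<open>g\<close> compares \<open>C\<close> with
  \<open>B\<close>, and then \<open>g'\<close> compares \<open>B\<close> with \<open>A\<close> on a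
  finite set chosen after \<open>g\<close>; the composite translate is
  \<open>g \<otimes> g'\<close>. No diagonal sequence is involved.\<close>

lemma finitely_dominates_trans:
  assumes AB: "finitely_dominates G A B" and BC: "finitely_dominates G B C"
    and sub: "A \<subseteq> carrier G" "B \<subseteq> carrier G" "C \<subseteq> carrier G"
  shows "finitely_dominates G A C"
proof -
  obtain F where F: "finite F" "F \<subseteq> carrier G"
    and domF: "\<forall>S. finite S \<and> S \<subseteq> carrier G \<longrightarrow>
      (\<exists>g\<in>carrier G. (\<forall>b\<in>B \<inter> S. \<exists>f\<in>F. f \<otimes> b \<otimes> g \<in> A) \<and>
        (\<forall>h\<in>S. h \<otimes> g \<in> A \<longrightarrow> (\<exists>f\<in>F. f \<otimes> h \<in> B)))"
    using AB by (rule finitely_dominatesE)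
  obtain H where H: "finite H" "H \<subseteq> carrier G"
    and domH: "\<forall>S. finite S \<and> S \<subseteq> carrier G \<longrightarrow>
      (\<exists>g\<in>carrier G. (\<forall>c\<in>C \<inter> S. \<exists>h\<in>H. h \<otimes> c \<otimes> g \<in> B) \<and>
        (\<forall>x\<in>S. x \<otimes> g \<in> B \<longrightarrow> (\<exists>h\<in>H. h \<otimes> x \<in> C)))"
    using BC by (rule finitely_dominatesE)
  \<comment> \<open>The first clause corrects by \<open>H\<close> and then by \<open>F\<close>, the
    second by \<open>F\<close> and then by \<open>H\<close>; hence both products.\<close>
  define K where "K = (F <#> H) \<union> (H <#> F)"
  have K: "finite K" "K \<subseteq> carrier G"
    using F H by (auto simp: K_def set_mult_def)
  have "\<exists>g\<in>carrier G. (\<forall>c\<in>C \<inter> S. \<exists>k\<in>K. k \<otimes> c \<otimes> g \<in> A) \<and>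
        (\<forall>x\<in>S. x \<otimes> g \<in> A \<longrightarrow> (\<exists>k\<in>K. k \<otimes> x \<in> C))"
    if S: "finite S" "S \<subseteq> carrier G" for S
  proof -
    \<comment> \<open>The test set contains \<open>F <#> S\<close> because in the second clause the
      element tested against \<open>C\<close> is \<open>f \<otimes> x\<close>, already corrected by
      some \<open>f\<close> in \<open>F\<close>.\<close>
    obtain g where g: "g \<in> carrier G"
      and g1: "\<And>c. c \<in> C \<inter> S \<Longrightarrow> \<exists>h\<in>H. h \<otimes> c \<otimes> g \<in> B"
      and g2: "\<And>x. x \<in> S \<union> (F <#> S) \<Longrightarrow> x \<otimes> g \<in> B \<Longrightarrow> \<exists>h\<in>H. h \<otimes> x \<in> C"
    proof -
      have "finite (S \<union> (F <#> S))" "S \<union> (F <#> S) \<subseteq> carrier G"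
        using S F by (auto simp: set_mult_def)
      then show thesis using domH[THEN spec, of "S \<union> (F <#> S)"] that by blast
    qed
    \<comment> \<open>These are the elements at which \<open>B\<close> is consulted:
      \<open>h \<otimes> c \<otimes> g\<close> in the first clause and \<open>x \<otimes> g\<close>
      in the second.\<close>
    define T where "T = (\<lambda>x. x \<otimes> g) ` (S \<union> (H <#> S))"
    have T: "finite T" "T \<subseteq> carrier G"
      using S H g by (auto simp: T_def set_mult_def)
    then obtain g' where g': "g' \<in> carrier G"
      and g'1: "\<And>b. b \<in> B \<inter> T \<Longrightarrow> \<exists>f\<in>F. f \<otimes> b \<otimes> g' \<in> A"
      and g'2: "\<And>x. x \<in> T \<Longrightarrow> x \<otimes> g' \<in> A \<Longrightarrow> \<exists>f\<in>F. f \<otimes> x \<in> B"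
      using domF[THEN spec, of T] by blast
    have "\<exists>k\<in>K. k \<otimes> c \<otimes> (g \<otimes> g') \<in> A" if c: "c \<in> C \<inter> S" for c
    proof -
      obtain h where h: "h \<in> H" "h \<otimes> c \<otimes> g \<in> B" using g1 c by blast
      then have "h \<otimes> c \<otimes> g \<in> T" using c by (auto simp: T_def set_mult_def)
      then obtain f where f: "f \<in> F" "f \<otimes> (h \<otimes> c \<otimes> g) \<otimes> g' \<in> A" using g'1 h by blast
      have "f \<otimes> h \<otimes> c \<otimes> (g \<otimes> g') = f \<otimes> (h \<otimes> c \<otimes> g) \<otimes> g'"
        using f h c g g' F(2) H(2) S(2) by (simp add: m_assoc subset_iff)
      moreover have "f \<otimes> h \<in> K" using f h by (auto simp: K_def set_mult_def)
      ultimately show ?thesis using f by metis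
    qed
    moreover have "\<exists>k\<in>K. k \<otimes> x \<in> C" if x: "x \<in> S" "x \<otimes> (g \<otimes> g') \<in> A" for x
    proof -
      have "x \<otimes> g \<in> T" using x by (auto simp: T_def)
      moreover have "x \<otimes> g \<otimes> g' \<in> A" using x g g' S(2) by (simp add: m_assoc subset_iff)
      ultimately obtain f where f: "f \<in> F" "f \<otimes> (x \<otimes> g) \<in> B" using g'2 by blast
      then have "f \<otimes> x \<otimes> g \<in> B" using x g F(2) S(2) by (simp add: m_assoc subset_iff)
      moreover have "f \<otimes> x \<in> S \<union> (F <#> S)" using f x by (auto simp: set_mult_def)
      ultimately obtain h where h: "h \<in> H" "h \<otimes> (f \<otimes> x) \<in> C" using g2 by blast
      then have "h \<otimes> f \<otimes> x \<in> C" using f x F(2) H(2) S(2) by (simp add: m_assoc subset_iff)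
      moreover have "h \<otimes> f \<in> K" using f h by (auto simp: K_def set_mult_def)
      ultimately show ?thesis by blast
    qed
    ultimately show ?thesis using g g' by (intro bexI[of _ "g \<otimes> g'"]) auto
  qed
  then show ?thesis unfolding finitely_dominates_def using K by blast
qed

text \<open>On a finite \<open>S\<close> the translates agree exactly with their limit
  \<open>B'\<close> for some \<open>n\<close>, so no correction beyond \<open>\<one>\<close> is
  needed for \<open>B'\<close>. The step from \<open>B'\<close> to \<open>B\<close> is
  transitivity.\<close>

lemma limit_dominates_imp_finitely_dominates:
  assumes "limit_dominates G A B" and sub: "A \<subseteq> carrier G" "B \<subseteq> carrier G"
  shows "finitely_dominates G A B"
proof -
  obtain g :: "nat \<Rightarrow> 'a" and B' where g: "range g \<subseteq> carrier G" and B': "B' \<subseteq> carrier G"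
    and lim: "sets_converge G (\<lambda>n. A #> g n) B'" and eq: "left_equiv G B B'"
    using assms unfolding limit_dominates_def by blast
  have "finitely_dominates G A B'"
    unfolding finitely_dominates_def
  proof (intro exI[of _ "{\<one>}"] conjI allI impI)
    fix S assume S: "finite S \<and> S \<subseteq> carrier G"
    have "\<forall>\<^sub>F n in sequentially. \<forall>h\<in>S. h \<in> A #> g n \<longleftrightarrow> h \<in> B'"
      using S lim by (auto simp: sets_converge_iff eventually_ball_finite_distrib)
    then obtain n where n: "\<And>h. h \<in> S \<Longrightarrow> h \<in> A #> g n \<longleftrightarrow> h \<in> B'"
      using eventually_happens'[OF sequentially_bot] by blast
    have gn: "g n \<in> carrier G" using g by blast
    have "h \<otimes> inv g n \<in> A \<longleftrightarrow> h \<in> B'" if "h \<in> S" for h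
      using n that r_coset_iff[OF sub(1) gn] S by blast
    then show "\<exists>g\<in>carrier G. (\<forall>b\<in>B' \<inter> S. \<exists>f\<in>{\<one>}. f \<otimes> b \<otimes> g \<in> A) \<and>
        (\<forall>h\<in>S. h \<otimes> g \<in> A \<longrightarrow> (\<exists>f\<in>{\<one>}. f \<otimes> h \<in> B'))"
      using gn S by (intro bexI[of _ "inv g n"]) (auto simp: subset_iff)
  qed auto
  moreover have "finitely_dominates G B' B"
    using eq left_equiv_sym left_equiv_imp_finitely_dominates sub B' by blast
  ultimately show ?thesis using finitely_dominates_trans sub B' by blast
qed

text \<open>The carrier is exhausted by finite sets \<open>S n\<close>, each with its own
  \<open>g n\<close>. A limit \<open>B'\<close> of a subsequence of the translates
  \<open>A #> inv g n\<close> is left equivalent to \<open>B\<close>, because the correcting set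
  \<open>F\<close> is the same for all \<open>n\<close>.\<close>

lemma finitely_dominates_imp_limit_dominates:
  assumes "countable (carrier G)"
    and "finitely_dominates G A B" and sub: "A \<subseteq> carrier G" "B \<subseteq> carrier G"
  shows "limit_dominates G A B"
proof -
  obtain F where F: "finite F" "F \<subseteq> carrier G"
    and dom: "\<forall>S. finite S \<and> S \<subseteq> carrier G \<longrightarrow>
      (\<exists>g\<in>carrier G. (\<forall>b\<in>B \<inter> S. \<exists>f\<in>F. f \<otimes> b \<otimes> g \<in> A) \<and>
        (\<forall>h\<in>S. h \<otimes> g \<in> A \<longrightarrow> (\<exists>f\<in>F. f \<otimes> h \<in> B)))"
    using assms(2) by (rule finitely_dominatesE)
  define S where "S n = from_nat_into (carrier G) ` {..n}" for n :: nat
  have S: "finite (S n)" "S n \<subseteq> carrier G" for n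
    using from_nat_into[of "carrier G"] by (auto simp: S_def)
  have S_ev: "\<forall>\<^sub>F n in sequentially. h \<in> S n" if h: "h \<in> carrier G" for h
  proof -
    obtain m where "from_nat_into (carrier G) m = h"
      using from_nat_into_surj[OF assms(1) h] by blast
    then show ?thesis
      unfolding eventually_sequentially S_def by (intro exI[of _ m]) auto
  qed
  have "\<forall>n. \<exists>g. g \<in> carrier G \<and> (\<forall>b\<in>B \<inter> S n. \<exists>f\<in>F. f \<otimes> b \<otimes> g \<in> A) \<and>
      (\<forall>h\<in>S n. h \<otimes> g \<in> A \<longrightarrow> (\<exists>f\<in>F. f \<otimes> h \<in> B))"
    using dom S by (simp add: Bex_def)
  from choice[OF this] obtain g where g: "\<And>n. g n \<in> carrier G"
    and g1: "\<And>n b. b \<in> B \<inter> S n \<Longrightarrow> \<exists>f\<in>F. f \<otimes> b \<otimes> g n \<in> A"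
    and g2: "\<And>n h. h \<in> S n \<Longrightarrow> h \<otimes> g n \<in> A \<Longrightarrow> \<exists>f\<in>F. f \<otimes> h \<in> B"
    by blast
  have coset: "h \<in> A #> inv g n \<longleftrightarrow> h \<otimes> g n \<in> A" if "h \<in> carrier G" for h n
    using r_coset_iff[OF sub(1) _ that, of "inv g n"] g by simp
  obtain k B' where k: "strict_mono (k :: nat \<Rightarrow> nat)" and B': "B' \<subseteq> carrier G"
    and lim: "sets_converge G ((\<lambda>n. A #> inv g n) \<circ> k) B'"
    using sets_converge_subsequence[OF assms(1)] .
  have limE: "\<forall>\<^sub>F n in sequentially. h \<otimes> g (k n) \<in> A \<longleftrightarrow> h \<in> B'" if "h \<in> carrier G" for h
    using lim that by (simp add: sets_converge_iff coset)
  have S_k: "\<forall>\<^sub>F n in sequentially. h \<in> S (k n)" if "h \<in> carrier G" for h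
    using eventually_compose_filterlim[OF S_ev[OF that] filterlim_subseq[OF k]] .
  have "\<exists>f\<in>F. f \<otimes> b \<in> B'" if b: "b \<in> B" for b
  proof -
    have bc: "b \<in> carrier G" using b sub by blast
    \<comment> \<open>Finiteness of \<open>F\<close> gives agreement of the translates with
      \<open>B'\<close> at all \<open>f \<otimes> b\<close> simultaneously. The conclusion drawn
      from it no longer mentions \<open>n\<close>, so holding eventually means holding.\<close>
    have "\<forall>\<^sub>F n in sequentially. \<forall>f\<in>F. f \<otimes> b \<otimes> g (k n) \<in> A \<longleftrightarrow> f \<otimes> b \<in> B'"
      using F bc limE by (auto simp: eventually_ball_finite_distrib)
    then have "\<forall>\<^sub>F n in sequentially. \<exists>f\<in>F. f \<otimes> b \<in> B'"
      using S_k[OF bc] by eventually_elim (use g1 b in blast)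
    then show ?thesis by simp
  qed
  moreover have "\<exists>f\<in>F. f \<otimes> h \<in> B" if h: "h \<in> B'" for h
  proof -
    have hc: "h \<in> carrier G" using h B' by blast
    have "\<forall>\<^sub>F n in sequentially. \<exists>f\<in>F. f \<otimes> h \<in> B"
      using S_k[OF hc] limE[OF hc] by eventually_elim (use g2 h in blast)
    then show ?thesis by simp
  qed
  ultimately have "left_equiv G B B'"
    unfolding left_equiv_def using left_finitely_covered_iff sub B' F by meson
  then show ?thesis
    unfolding limit_dominates_def using lim B' g
    by (intro exI[of _ "\<lambda>n. inv g (k n)"] exI[of _ B']) (auto simp: o_def)
qed

lemma limit_equiv_iff:
  assumes "countable (carrier G)" "A \<subseteq> carrier G" "B \<subseteq> carrier G"
  shows "limit_equiv G A B \<longleftrightarrow> finitely_dominates G A B \<and> finitely_dominates G B A"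
  unfolding limit_equiv_def
  using assms finitely_dominates_imp_limit_dominates limit_dominates_imp_finitely_dominates
  by blast

text \<open>The finitary form supplies the transitivity of \<open>limit_equiv\<close> that makes the
  classes of equivalent sets equal.\<close>

lemma limit_class_eq_iff:
  assumes "countable (carrier G)" "A \<subseteq> carrier G" "B \<subseteq> carrier G" "B \<noteq> {}"
  shows "limit_class G A = limit_class G B \<longleftrightarrow> limit_equiv G A B"
proof
  assume "limit_class G A = limit_class G B"
  moreover have "B \<in> limit_class G B"
    using assms
    by (simp add: limit_class_def limit_equiv_iff left_equiv_refl left_equiv_imp_finitely_dominates)
  ultimately show "limit_equiv G A B" by (auto simp: limit_class_def)
next
  assume eq: "limit_equiv G A B"
  have "limit_equiv G A C \<longleftrightarrow> limit_equiv G B C" if "C \<subseteq> carrier G" for C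
    using eq assms that by (metis limit_equiv_iff finitely_dominates_trans)
  then show "limit_class G A = limit_class G B"
    unfolding limit_class_def by blast
qed

end


section \<open>Return sets and types\<close>

locale lc_G_space =
  fixes G :: "('g, 'm) monoid_scheme" (structure) and X :: "'x topology" and \<phi>
  assumes lc_G_space: "locally_compact_G_space G X \<phi>"
begin

sublocale group_action G "topspace X" \<phi>
  using lc_G_space by (simp add: locally_compact_G_space_def)

sublocale group G
  using group_hom by (rule group_hom.axioms(1))

lemma act_closed: "g \<in> carrier G \<Longrightarrow> x \<in> topspace X \<Longrightarrow> \<phi> g x \<in> topspace X"
  using element_image by blast

lemma act_one: "x \<in> topspace X \<Longrightarrow> \<phi> \<one> x = x"
  using id_eq_one by (metis restrict_apply')

lemma act_inv: "g \<in> carrier G \<Longrightarrow> x \<in> topspace X \<Longrightarrow> \<phi> (inv g) (\<phi> g x) = x"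
  using orbit_sym_aux by blast

lemma act_continuous: "g \<in> carrier G \<Longrightarrow> continuous_map X X (\<phi> g)"
  using lc_G_space by (auto simp: locally_compact_G_space_def intro: homeomorphic_imp_continuous_map)

lemma Hausdorff: "Hausdorff_space X"
  using lc_G_space by (simp add: locally_compact_G_space_def)

lemma openin_act_vimage:
  "g \<in> carrier G \<Longrightarrow> openin X U \<Longrightarrow> openin X {y \<in> topspace X. \<phi> g y \<in> U}"
  using act_continuous openin_continuous_map_preimage by blast

lemma compactin_act_vimage:
  assumes "g \<in> carrier G" "compactin X K"
  shows "compactin X {y \<in> topspace X. \<phi> g y \<in> K}"
proof -
  have "{y \<in> topspace X. \<phi> g y \<in> K} = \<phi> (inv g) ` K"
  proof (intro equalityI subsetI)
    fix y assume "y \<in> {y \<in> topspace X. \<phi> g y \<in> K}"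
    then show "y \<in> \<phi> (inv g) ` K" using act_inv[OF assms(1), of y] by force
  next
    fix y assume "y \<in> \<phi> (inv g) ` K"
    then obtain k where k: "k \<in> K" "y = \<phi> (inv g) k" by blast
    then have "k \<in> topspace X" using assms compactin_subset_topspace by blast
    then show "y \<in> {y \<in> topspace X. \<phi> g y \<in> K}"
      using k assms act_closed act_inv[of "inv g" k] by auto
  qed
  then show ?thesis using image_compactin[OF assms(2) act_continuous] assms(1) by simp
qed

text \<open>In a Hausdorff space a compact \<open>L\<close> is closed and so contains the closure of
  every subset. Later proofs therefore only have to exhibit some compact superset.\<close>

lemma rel_compact_sets_iff:
  assumes "x \<in> topspace X"
  shows "B \<in> rel_compact_sets G X \<phi> x \<longleftrightarrow>
    B \<subseteq> carrier G \<and> (\<exists>L. compactin X L \<and> (\<forall>b\<in>B. \<phi> b x \<in> L))"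
proof
  assume B: "B \<in> rel_compact_sets G X \<phi> x"
  then have "(\<lambda>g. \<phi> g x) ` B \<subseteq> topspace X"
    using assms act_closed by (auto simp: rel_compact_sets_def)
  from closure_of_subset[OF this]
  show "B \<subseteq> carrier G \<and> (\<exists>L. compactin X L \<and> (\<forall>b\<in>B. \<phi> b x \<in> L))"
    using B unfolding rel_compact_sets_def by blast
next
  assume B: "B \<subseteq> carrier G \<and> (\<exists>L. compactin X L \<and> (\<forall>b\<in>B. \<phi> b x \<in> L))"
  then obtain L where L: "compactin X L" "(\<lambda>g. \<phi> g x) ` B \<subseteq> L" by blast
  have "X closure_of ((\<lambda>g. \<phi> g x) ` B) \<subseteq> L"
    using L Hausdorff by (intro closure_of_minimal compactin_imp_closedin)
  then have "compactin X (X closure_of ((\<lambda>g. \<phi> g x) ` B))"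
    using L(1) closed_compactin closedin_closure_of by blast
  then show "B \<in> rel_compact_sets G X \<phi> x" using B by (simp add: rel_compact_sets_def)
qed

end

definition return_set where
  "return_set G \<phi> x K = {g \<in> carrier G. \<phi> g x \<in> K}"

lemma return_set_subset: "return_set G \<phi> x K \<subseteq> carrier G"
  by (auto simp: return_set_def)

text \<open>Without first countability no convergent subsequence can be expected. If no point of
  \<open>M\<close> were a cluster point, each would have a neighbourhood that is eventually avoided,
  and a finite subcover would make the sequence avoid \<open>M\<close>.\<close>

lemma compactin_sequence_cluster_point:
  assumes "compactin X M" and z: "\<forall>\<^sub>F n in sequentially. z n \<in> M"
  shows "\<exists>x\<in>M. \<forall>W. openin X W \<and> x \<in> W \<longrightarrow> (\<exists>\<^sub>F n in sequentially. z n \<in> W)"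
proof (rule ccontr)
  assume "\<not> ?thesis"
  then have "\<forall>x\<in>M. \<exists>W. openin X W \<and> x \<in> W \<and> (\<forall>\<^sub>F n in sequentially. z n \<notin> W)"
    by (auto simp: frequently_def)
  then obtain W where W: "\<And>x. x \<in> M \<Longrightarrow> openin X (W x) \<and> x \<in> W x"
    and ev: "\<And>x. x \<in> M \<Longrightarrow> \<forall>\<^sub>F n in sequentially. z n \<notin> W x"
    by metis
  obtain \<F> where "finite \<F>" "\<F> \<subseteq> W ` M" "M \<subseteq> \<Union>\<F>"
    using compactinD[OF assms(1), of "W ` M"] W by blast
  then obtain T where T: "finite T" "T \<subseteq> M" "M \<subseteq> \<Union>(W ` T)"
    by (metis finite_subset_image)
  have "\<forall>\<^sub>F n in sequentially. \<forall>x\<in>T. z n \<notin> W x"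
    using T ev by (auto simp: eventually_ball_finite_distrib)
  then have "\<forall>\<^sub>F n in sequentially. False"
    using z by eventually_elim (use T in blast)
  then show False by simp
qed

section \<open>Minimal spaces\<close>

locale minimal_space = lc_G_space +
  assumes minimal: "minimal_G_space G X \<phi>"
begin

lemma nonempty: "topspace X \<noteq> {}"
  using minimal by (simp add: minimal_G_space_def)

lemma orbit_meets_open:
  assumes "x \<in> topspace X" "openin X U" "U \<noteq> {}"
  shows "\<exists>g\<in>carrier G. \<phi> g x \<in> U"
proof -
  obtain u where u: "u \<in> U" using assms by blast
  then have "u \<in> X closure_of (orbit G \<phi> x)"
    using assms minimal openin_subset by (fastforce simp: minimal_G_space_def dense_orbit_def)
  then show ?thesis using assms u by (auto simp: in_closure_of orbit_def)
qed

text \<open>Every orbit meets \<open>U\<close>, so the preimages of \<open>U\<close> under the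
  action form an open cover. The resulting finite \<open>F\<close> becomes the finite set in the
  left coverings of return sets.\<close>

lemma compact_cover:
  assumes "compactin X L" "openin X U" "U \<noteq> {}"
  obtains F where "finite F" "F \<subseteq> carrier G" "\<And>y. y \<in> L \<Longrightarrow> \<exists>f\<in>F. \<phi> f y \<in> U"
proof -
  let ?V = "\<lambda>g. {y \<in> topspace X. \<phi> g y \<in> U}"
  have "L \<subseteq> \<Union>(?V ` carrier G)"
    using compactin_subset_topspace[OF assms(1)] orbit_meets_open assms by blast
  then obtain \<F> where \<F>: "finite \<F>" "\<F> \<subseteq> ?V ` carrier G" "L \<subseteq> \<Union>\<F>"
    using compactinD[OF assms(1), of "?V ` carrier G"] openin_act_vimage assms by blast
  obtain F where "F \<subseteq> carrier G" "finite F" "\<F> = ?V ` F"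
    using finite_subset_image[OF \<F>(1,2)] by auto
  then have "finite F" "F \<subseteq> carrier G" "L \<subseteq> \<Union>(?V ` F)"
    using \<F>(3) by simp_all
  then show thesis using that[of F] by blast
qed

lemma compact_neighbourhood:
  obtains U K where "openin X U" "U \<noteq> {}" "U \<subseteq> K" "compactin X K"
  using lc_G_space nonempty
  unfolding locally_compact_G_space_def locally_compact_space_def by blast

section \<open>Types read off from a compact neighbourhood\<close>

context
  fixes U K
  assumes U: "openin X U" "U \<noteq> {}" "U \<subseteq> K" and K: "compactin X K"
begin

lemma closedin_K: "closedin X K"
  using K Hausdorff compactin_imp_closedin by blast

lemma return_set_nonempty: "x \<in> topspace X \<Longrightarrow> return_set G \<phi> x K \<noteq> {}"
  using orbit_meets_open[of x U] U by (auto simp: return_set_def)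

text \<open>A compact \<open>L\<close> is moved into \<open>U\<close>, hence into \<open>K\<close>,
  by finitely many group elements. Conversely, the preimages of \<open>K\<close> under finitely many
  elements have a compact union.\<close>

lemma rel_compact_sets_eq:
  assumes x: "x \<in> topspace X"
  shows "rel_compact_sets G X \<phi> x = covered_sets G (return_set G \<phi> x K)"
proof (intro equalityI subsetI)
  fix B assume "B \<in> rel_compact_sets G X \<phi> x"
  then obtain L where B: "B \<subseteq> carrier G" and L: "compactin X L" "\<And>b. b \<in> B \<Longrightarrow> \<phi> b x \<in> L"
    by (auto simp: rel_compact_sets_iff[OF x])
  obtain F where F: "finite F" "F \<subseteq> carrier G" "\<And>y. y \<in> L \<Longrightarrow> \<exists>f\<in>F. \<phi> f y \<in> U"
    using compact_cover[OF L(1) U(1,2)] by metis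
  have "\<exists>f\<in>F. f \<otimes> b \<in> return_set G \<phi> x K" if b: "b \<in> B" for b
  proof -
    obtain f where f: "f \<in> F" "\<phi> f (\<phi> b x) \<in> U" using F(3) L(2) b by blast
    moreover have "f \<in> carrier G" "b \<in> carrier G" using f b B F(2) by blast+
    ultimately have "f \<otimes> b \<in> return_set G \<phi> x K"
      using x U(3) composition_rule[of x f b] by (auto simp: return_set_def)
    then show ?thesis using f(1) by blast
  qed
  then have "left_finitely_covered G B (return_set G \<phi> x K)"
    unfolding left_finitely_covered_iff[OF B return_set_subset] using F(1,2) by blast
  then show "B \<in> covered_sets G (return_set G \<phi> x K)"
    using B by (simp add: covered_sets_def)
next
  fix B assume B': "B \<in> covered_sets G (return_set G \<phi> x K)"
  then have B: "B \<subseteq> carrier G" by (simp add: covered_sets_def)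
  obtain F where F: "finite F" "F \<subseteq> carrier G"
      "\<And>b. b \<in> B \<Longrightarrow> \<exists>f\<in>F. f \<otimes> b \<in> return_set G \<phi> x K"
    using B' by (auto simp: covered_sets_def left_finitely_covered_iff[OF B return_set_subset])
  let ?L = "\<Union>f\<in>F. {y \<in> topspace X. \<phi> f y \<in> K}"
  have "compactin X ?L"
    using F K by (intro compactin_Union) (auto intro: compactin_act_vimage)
  moreover have "\<phi> b x \<in> ?L" if b: "b \<in> B" for b
  proof -
    obtain f where f: "f \<in> F" "f \<otimes> b \<in> return_set G \<phi> x K" using F(3) b by blast
    moreover have "f \<in> carrier G" "b \<in> carrier G" using f b B F(2) by blast+
    ultimately have "\<phi> b x \<in> {y \<in> topspace X. \<phi> f y \<in> K}"
      using x act_closed composition_rule[of x f b] by (simp add: return_set_def)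
    then show ?thesis using f(1) by blast
  qed
  ultimately show "B \<in> rel_compact_sets G X \<phi> x"
    using rel_compact_sets_iff[OF x] B by blast
qed

lemma pointed_type_eq:
  assumes x: "x \<in> topspace X"
  shows "pointed_type G X \<phi> x = left_class G (return_set G \<phi> x K)"
  unfolding pointed_type_def
proof (rule the_equality)
  show "\<exists>A\<subseteq>carrier G. A \<noteq> {} \<and> rel_compact_sets G X \<phi> x = covered_sets G A \<and>
      left_class G (return_set G \<phi> x K) = left_class G A"
    using rel_compact_sets_eq[OF x] return_set_nonempty[OF x]
    by (intro exI[of _ "return_set G \<phi> x K"]) (simp add: return_set_subset)
next
  fix c
  assume "\<exists>A\<subseteq>carrier G. A \<noteq> {} \<and> rel_compact_sets G X \<phi> x = covered_sets G A \<and>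
      c = left_class G A"
  then show "c = left_class G (return_set G \<phi> x K)"
    by (metis rel_compact_sets_eq covered_sets_eq_iff left_class_eq_iff return_set_nonempty
        return_set_subset x)
qed

text \<open>The orbit of \<open>x\<close> comes so close to \<open>y\<close> that, for all
  \<open>s\<close> in the finite set \<open>S\<close>, the behaviour of \<open>s\<close> at
  \<open>y\<close> relative to \<open>K\<close> is retained at \<open>\<phi> g x\<close>, up to a
  correction by \<open>F\<close>.\<close>

lemma return_set_finitely_dominates:
  assumes x: "x \<in> topspace X" and y: "y \<in> topspace X"
  shows "finitely_dominates G (return_set G \<phi> x K) (return_set G \<phi> y K)"
proof -
  obtain F where F: "finite F" "F \<subseteq> carrier G" "\<And>y. y \<in> K \<Longrightarrow> \<exists>f\<in>F. \<phi> f y \<in> U"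
    using compact_cover[OF K U(1,2)] by metis
  \<comment> \<open>\<open>p k\<close> is a fixed choice of an element of \<open>F\<close> carrying
    \<open>k\<close> into \<open>U\<close>.\<close>
  then obtain p where p: "\<And>k. k \<in> K \<Longrightarrow> p k \<in> F" "\<And>k. k \<in> K \<Longrightarrow> \<phi> (p k) k \<in> U"
    by metis
  have "\<exists>g\<in>carrier G.
      (\<forall>b\<in>return_set G \<phi> y K \<inter> S. \<exists>f\<in>insert \<one> F. f \<otimes> b \<otimes> g \<in> return_set G \<phi> x K) \<and>
      (\<forall>h\<in>S. h \<otimes> g \<in> return_set G \<phi> x K \<longrightarrow> (\<exists>f\<in>insert \<one> F. f \<otimes> h \<in> return_set G \<phi> y K))"
    if S: "finite S" "S \<subseteq> carrier G" for S
  proof -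
    define W where "W s = (if \<phi> s y \<in> K then {z \<in> topspace X. \<phi> (p (\<phi> s y) \<otimes> s) z \<in> U}
      else {z \<in> topspace X. \<phi> s z \<in> topspace X - K})" for s
    have "openin X (W s)" if "s \<in> S" for s
    proof (cases "\<phi> s y \<in> K")
      case True
      then have "p (\<phi> s y) \<otimes> s \<in> carrier G" using p(1) F(2) that S(2) by blast
      then show ?thesis using True U(1) by (simp add: W_def openin_act_vimage)
    next
      case False
      have "openin X (topspace X - K)" using closedin_K by blast
      then show ?thesis
        using False openin_act_vimage[of s "topspace X - K"] that S(2) by (auto simp: W_def)
    qed
    \<comment> \<open>The intersection with the whole space matters for empty \<open>S\<close>,
      where the indexed intersection is the universe of the type.\<close>
    then have "openin X ((\<Inter>s\<in>S. W s) \<inter> topspace X)"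
      using S(1) by (intro openin_INT) auto
    moreover have "y \<in> W s" if s: "s \<in> S" for s
      using s S(2) F(2) p y act_closed composition_rule[of y "p (\<phi> s y)" s]
      by (auto simp: W_def subset_iff)
    then have "y \<in> (\<Inter>s\<in>S. W s) \<inter> topspace X" using y by blast
    ultimately obtain g where g: "g \<in> carrier G" and gW: "\<And>s. s \<in> S \<Longrightarrow> \<phi> g x \<in> W s"
      using orbit_meets_open[OF x, of "(\<Inter>s\<in>S. W s) \<inter> topspace X"] by blast
    have "\<exists>f\<in>insert \<one> F. f \<otimes> b \<otimes> g \<in> return_set G \<phi> x K"
      if b: "b \<in> return_set G \<phi> y K" "b \<in> S" for b
    proof -
      have bK: "\<phi> b y \<in> K" using b by (simp add: return_set_def)
      let ?f = "p (\<phi> b y)"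
      have f: "?f \<in> carrier G" using p(1) bK F(2) by blast
      have "\<phi> (?f \<otimes> b) (\<phi> g x) \<in> U" using gW[OF b(2)] bK by (simp add: W_def)
      then have "?f \<otimes> b \<otimes> g \<in> return_set G \<phi> x K"
        using f b S(2) g x U(3) composition_rule[of x "?f \<otimes> b" g]
        by (auto simp: return_set_def)
      then show ?thesis using p(1)[OF bK] by blast
    qed
    moreover have "h \<in> return_set G \<phi> y K" if h: "h \<in> S" "h \<otimes> g \<in> return_set G \<phi> x K" for h
    proof -
      have hc: "h \<in> carrier G" using h S by blast
      then have "\<phi> h (\<phi> g x) \<in> K"
        using h g x composition_rule[of x h g] by (simp add: return_set_def)
      then show ?thesis using gW[OF h(1)] hc by (auto simp: W_def return_set_def split: if_splits)
    qed
    ultimately show ?thesis using g S(2) by (intro bexI[of _ g]) (auto simp: subset_iff)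
  qed
  then show ?thesis
    unfolding finitely_dominates_def using F(1,2) by (intro exI[of _ "insert \<one> F"]) auto
qed

text \<open>The \<open>THE\<close> ranges over all points and all representatives. A change of
  representative is covered by \<open>left_equiv\<close>, a change of point by
  \<open>return_set_finitely_dominates\<close> used in both directions.\<close>

lemma space_type_eq:
  assumes "countable (carrier G)" and x: "x \<in> topspace X"
  shows "space_type G X \<phi> = limit_class G (return_set G \<phi> x K)"
  unfolding space_type_def
proof (rule the_equality)
  show "\<exists>y A. y \<in> topspace X \<and> dense_orbit G X \<phi> y \<and> A \<subseteq> carrier G \<and> A \<noteq> {} \<and>
      pointed_type G X \<phi> y = left_class G A \<and>
      limit_class G (return_set G \<phi> x K) = limit_class G A"
    using minimal x pointed_type_eq[OF x] return_set_nonempty[OF x]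
    by (intro exI[of _ x] exI[of _ "return_set G \<phi> x K"])
      (simp add: return_set_subset minimal_G_space_def)
next
  fix c
  assume "\<exists>y A. y \<in> topspace X \<and> dense_orbit G X \<phi> y \<and> A \<subseteq> carrier G \<and> A \<noteq> {} \<and>
      pointed_type G X \<phi> y = left_class G A \<and> c = limit_class G A"
  then obtain y A where y: "y \<in> topspace X" and A: "A \<subseteq> carrier G" "A \<noteq> {}"
    and type: "pointed_type G X \<phi> y = left_class G A" and c: "c = limit_class G A"
    by blast
  have "left_class G (return_set G \<phi> y K) = left_class G A"
    using type pointed_type_eq[OF y] by simp
  then have "left_equiv G (return_set G \<phi> y K) A"
    by (rule left_class_eq_iff[OF return_set_subset A, THEN iffD1])
  then have "finitely_dominates G (return_set G \<phi> y K) A"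
      "finitely_dominates G A (return_set G \<phi> y K)"
    using left_equiv_imp_finitely_dominates left_equiv_sym A return_set_subset by metis+
  then have "limit_equiv G A (return_set G \<phi> x K)"
    using limit_equiv_iff[OF assms(1) A(1) return_set_subset] return_set_finitely_dominates
      finitely_dominates_trans return_set_subset x y A(1) by meson
  then show "c = limit_class G (return_set G \<phi> x K)"
    using limit_class_eq_iff assms A return_set_subset return_set_nonempty x c by metis
qed

text \<open>The translate of the return set of \<open>y\<close> by \<open>g n\<close> is the return
  set of \<open>z n\<close>. At a cluster point \<open>x\<close> of these points, closedness of
  \<open>K\<close> bounds the limit \<open>A'\<close> from above by the return set of
  \<open>x\<close>, and openness of \<open>U\<close> bounds it from below up to a finite
  set.\<close>

lemma limit_dominates_imp_rel_compact_sets_eq: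
  assumes y: "y \<in> topspace X" and A: "A \<subseteq> carrier G" "A \<noteq> {}"
    and dom: "limit_dominates G (return_set G \<phi> y K) A"
  shows "\<exists>x\<in>topspace X. rel_compact_sets G X \<phi> x = covered_sets G A"
proof -
  obtain g :: "nat \<Rightarrow> 'a" and A' where g: "range g \<subseteq> carrier G" and A': "A' \<subseteq> carrier G"
    and lim: "sets_converge G (\<lambda>n. return_set G \<phi> y K #> g n) A'" and eq: "left_equiv G A A'"
    using dom unfolding limit_dominates_def by blast
  have gn: "g n \<in> carrier G" for n using g by blast
  define z where "z n = \<phi> (inv (g n)) y" for n
  have z: "z n \<in> topspace X" for n using gn y act_closed by (simp add: z_def)
  have limE: "\<forall>\<^sub>F n in sequentially. \<phi> h (z n) \<in> K \<longleftrightarrow> h \<in> A'" if h: "h \<in> carrier G" for h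
  proof -
    have "h \<in> return_set G \<phi> y K #> g n \<longleftrightarrow> \<phi> h (z n) \<in> K" for n
      unfolding r_coset_iff[OF return_set_subset gn h]
      using gn[of n] h y composition_rule[of y h "inv (g n)"]
      by (simp add: return_set_def z_def)
    moreover have "\<forall>\<^sub>F n in sequentially. h \<in> return_set G \<phi> y K #> g n \<longleftrightarrow> h \<in> A'"
      using lim h by (simp add: sets_converge_iff)
    ultimately show ?thesis by simp
  qed
  \<comment> \<open>Since \<open>A\<close> is non-empty, so is \<open>A'\<close>. One element
    \<open>a\<close> of it eventually confines \<open>z n\<close> to a compact preimage of
    \<open>K\<close>, without which there might be no cluster point.\<close>
  obtain a where a: "a \<in> A'"
    using eq A left_finitely_covered_iff[OF A(1) A'] unfolding left_equiv_def by blast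
  then have ac: "a \<in> carrier G" using A' by blast
  have "\<forall>\<^sub>F n in sequentially. z n \<in> {x \<in> topspace X. \<phi> a x \<in> K}"
    using limE[OF ac] by eventually_elim (use a z in auto)
  then obtain x where x: "x \<in> topspace X"
    and cluster: "\<And>W. openin X W \<Longrightarrow> x \<in> W \<Longrightarrow> \<exists>\<^sub>F n in sequentially. z n \<in> W"
    using compactin_sequence_cluster_point[OF compactin_act_vimage[OF ac K]] by blast
  have sub: "h \<in> return_set G \<phi> x K" if h: "h \<in> A'" for h
  proof (rule ccontr)
    assume n: "h \<notin> return_set G \<phi> x K"
    have hc: "h \<in> carrier G" using h A' by blast
    have "\<exists>\<^sub>F n in sequentially. z n \<in> {x \<in> topspace X. \<phi> h x \<in> topspace X - K}"
      using n hc x act_closed closedin_K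
      by (intro cluster openin_act_vimage) (auto simp: return_set_def)
    from frequently_ex[OF frequently_eventually_frequently[OF this limE[OF hc]]]
    show False using h by simp
  qed
  obtain F where F: "finite F" "F \<subseteq> carrier G" "\<And>y. y \<in> K \<Longrightarrow> \<exists>f\<in>F. \<phi> f y \<in> U"
    using compact_cover[OF K U(1,2)] by metis
  \<comment> \<open>A cluster point gives \<open>\<phi> (f \<otimes> h) (z n) \<in> U\<close> only
    frequently, but membership in \<open>K\<close> eventually has a constant truth value, that of
    \<open>f \<otimes> h \<in> A'\<close>; one common \<open>n\<close> decides it.\<close>
  have "\<exists>f\<in>F. f \<otimes> h \<in> A'" if h: "h \<in> return_set G \<phi> x K" for h
  proof -
    have hc: "h \<in> carrier G" using h by (simp add: return_set_def)
    obtain f where f: "f \<in> F" "\<phi> f (\<phi> h x) \<in> U" using F(3) h by (auto simp: return_set_def)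
    then have fc: "f \<in> carrier G" using F by blast
    have fh: "f \<otimes> h \<in> carrier G" using fc hc by simp
    have "\<exists>\<^sub>F n in sequentially. z n \<in> {x \<in> topspace X. \<phi> (f \<otimes> h) x \<in> U}"
      using f fc hc fh x U(1) composition_rule[of x f h]
      by (intro cluster openin_act_vimage) auto
    from frequently_ex[OF frequently_eventually_frequently[OF this limE[OF fh]]]
    show ?thesis using f(1) U(3) by blast
  qed
  then have "left_finitely_covered G (return_set G \<phi> x K) A'"
    unfolding left_finitely_covered_iff[OF return_set_subset A'] using F(1,2) by blast
  moreover have "left_finitely_covered G A' (return_set G \<phi> x K)"
    using sub by (intro subset_imp_left_finitely_covered return_set_subset) blast
  ultimately have "left_equiv G A' (return_set G \<phi> x K)" by (simp add: left_equiv_def)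
  note equiv = left_equiv_trans[OF eq this A(1) A' return_set_subset]
  then show ?thesis
    using x equiv rel_compact_sets_eq covered_sets_eq_iff A(1) return_set_subset by metis
qed

end

end

section \<open>Comparison of the types of two spaces\<close>

lemma minimal_spaceI: "minimal_G_space G X \<phi> \<Longrightarrow> minimal_space G X \<phi>"
  by unfold_locales (simp_all add: minimal_G_space_def)

text \<open>Equality of the classes and equality of the families both amount to left equivalence of
  two return sets. This removes the \<open>THE\<close> from later arguments.\<close>

lemma pointed_type_eq_iff:
  assumes "minimal_G_space G X \<phi>" "minimal_G_space G Y \<psi>" "x \<in> topspace X" "y \<in> topspace Y"
  shows "pointed_type G X \<phi> x = pointed_type G Y \<psi> y \<longleftrightarrow>
    rel_compact_sets G X \<phi> x = rel_compact_sets G Y \<psi> y"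
proof -
  interpret X: minimal_space G X \<phi> by (rule minimal_spaceI) fact
  interpret Y: minimal_space G Y \<psi> by (rule minimal_spaceI) fact
  obtain U K where "openin X U" "U \<noteq> {}" "U \<subseteq> K" "compactin X K"
    by (rule X.compact_neighbourhood)
  note X = this
  obtain V L where "openin Y V" "V \<noteq> {}" "V \<subseteq> L" "compactin Y L"
    by (rule Y.compact_neighbourhood)
  note Y = this
  show ?thesis
    using X.rel_compact_sets_eq[OF X assms(3)] Y.rel_compact_sets_eq[OF Y assms(4)]
      X.pointed_type_eq[OF X assms(3)] Y.pointed_type_eq[OF Y assms(4)]
      X.covered_sets_eq_iff X.left_class_eq_iff Y.return_set_nonempty[OF Y assms(4)]
      return_set_subset by metis
qed

lemma space_type_cong:
  assumes "countable (carrier G)" "minimal_G_space G X \<phi>" "minimal_G_space G Y \<psi>"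
    "x \<in> topspace X" "y \<in> topspace Y"
    and type: "pointed_type G X \<phi> x = pointed_type G Y \<psi> y"
  shows "space_type G X \<phi> = space_type G Y \<psi>"
proof -
  interpret X: minimal_space G X \<phi> by (rule minimal_spaceI) fact
  interpret Y: minimal_space G Y \<psi> by (rule minimal_spaceI) fact
  obtain U K where "openin X U" "U \<noteq> {}" "U \<subseteq> K" "compactin X K"
    by (rule X.compact_neighbourhood)
  note X = this
  obtain V L where "openin Y V" "V \<noteq> {}" "V \<subseteq> L" "compactin Y L"
    by (rule Y.compact_neighbourhood)
  note Y = this
  let ?A = "return_set G \<phi> x K" and ?B = "return_set G \<psi> y L"
  have "left_equiv G ?A ?B"
    using type X.pointed_type_eq[OF X assms(4)] Y.pointed_type_eq[OF Y assms(5)]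
      X.left_class_eq_iff Y.return_set_nonempty[OF Y assms(5)] return_set_subset by metis
  then have "limit_equiv G ?A ?B"
    using X.limit_equiv_iff assms(1) return_set_subset X.left_equiv_sym
      X.left_equiv_imp_finitely_dominates by metis
  then have "limit_class G ?A = limit_class G ?B"
    using X.limit_class_eq_iff assms(1) return_set_subset Y.return_set_nonempty[OF Y assms(5)]
    by metis
  then show ?thesis
    using X.space_type_eq[OF X assms(1,4)] Y.space_type_eq[OF Y assms(1,5)] by simp
qed

text \<open>The return set of \<open>y\<close> is dominated by that of an arbitrary point
  \<open>w\<close> of \<open>X\<close>, so it is realized as a pointed type in \<open>X\<close> at a
  limit of translates of \<open>w\<close>.\<close>

lemma space_type_eq_imp_pointed_type_eq:
  assumes "countable (carrier G)" "minimal_G_space G X \<phi>" "minimal_G_space G Y \<psi>"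
    and y: "y \<in> topspace Y" and type: "space_type G X \<phi> = space_type G Y \<psi>"
  obtains x where "x \<in> topspace X" "pointed_type G X \<phi> x = pointed_type G Y \<psi> y"
proof -
  interpret X: minimal_space G X \<phi> by (rule minimal_spaceI) fact
  interpret Y: minimal_space G Y \<psi> by (rule minimal_spaceI) fact
  obtain U K where "openin X U" "U \<noteq> {}" "U \<subseteq> K" "compactin X K"
    by (rule X.compact_neighbourhood)
  note X = this
  obtain V L where "openin Y V" "V \<noteq> {}" "V \<subseteq> L" "compactin Y L"
    by (rule Y.compact_neighbourhood)
  note Y = this
  obtain w where w: "w \<in> topspace X" using X.nonempty by blast
  let ?A = "return_set G \<phi> w K" and ?B = "return_set G \<psi> y L"
  have "limit_class G ?A = limit_class G ?B"
    using type X.space_type_eq[OF X assms(1) w] Y.space_type_eq[OF Y assms(1) y] by simp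
  then have "limit_dominates G ?A ?B"
    using X.limit_class_eq_iff assms(1) return_set_subset Y.return_set_nonempty[OF Y y]
    unfolding limit_equiv_def by metis
  then have "\<exists>x\<in>topspace X. rel_compact_sets G X \<phi> x = covered_sets G ?B"
    by (rule X.limit_dominates_imp_rel_compact_sets_eq[OF X w return_set_subset
          Y.return_set_nonempty[OF Y y]])
  then obtain x where "x \<in> topspace X" "rel_compact_sets G X \<phi> x = covered_sets G ?B" ..
  then show thesis
    using that pointed_type_eq_iff assms y Y.rel_compact_sets_eq[OF Y y] by metis
qed

text \<open>Compact supersets are pulled back by properness and pushed forward by continuity, so the
  two families of relatively compact sets coincide.\<close>

lemma proper_G_map_imp_pointed_type_eq:
  assumes "minimal_G_space G Z \<psi>" "minimal_G_space G X \<phi>" and f: "proper_G_map G Z \<psi> X \<phi> f"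
    and z: "z \<in> topspace Z"
  shows "f z \<in> topspace X" "pointed_type G X \<phi> (f z) = pointed_type G Z \<psi> z"
proof -
  interpret X: minimal_space G X \<phi> by (rule minimal_spaceI) fact
  interpret Z: minimal_space G Z \<psi> by (rule minimal_spaceI) fact
  have cont: "continuous_map Z X f"
    and proper: "\<And>K. compactin X K \<Longrightarrow> compactin Z {z \<in> topspace Z. f z \<in> K}"
    and equi: "\<And>g z. g \<in> carrier G \<Longrightarrow> z \<in> topspace Z \<Longrightarrow> f (\<psi> g z) = \<phi> g (f z)"
    using f by (auto simp: proper_G_map_def)
  show fz: "f z \<in> topspace X"
    using cont z continuous_map_image_subset_topspace by blast
  have "B \<in> rel_compact_sets G X \<phi> (f z) \<longleftrightarrow> B \<in> rel_compact_sets G Z \<psi> z" for B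
    unfolding X.rel_compact_sets_iff[OF fz] Z.rel_compact_sets_iff[OF z]
  proof (intro conj_cong refl iffI)
    assume B: "B \<subseteq> carrier G" and "\<exists>L. compactin X L \<and> (\<forall>b\<in>B. \<phi> b (f z) \<in> L)"
    then obtain L where L: "compactin X L" "\<And>b. b \<in> B \<Longrightarrow> \<phi> b (f z) \<in> L" by blast
    show "\<exists>L. compactin Z L \<and> (\<forall>b\<in>B. \<psi> b z \<in> L)"
      using proper[OF L(1)] L(2) B equi z Z.act_closed
      by (intro exI[of _ "{z \<in> topspace Z. f z \<in> L}"]) (auto simp: subset_iff)
  next
    assume B: "B \<subseteq> carrier G" and "\<exists>L. compactin Z L \<and> (\<forall>b\<in>B. \<psi> b z \<in> L)"
    then obtain L where L: "compactin Z L" "\<And>b. b \<in> B \<Longrightarrow> \<psi> b z \<in> L" by blast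
    have "\<phi> b (f z) \<in> f ` L" if "b \<in> B" for b
      using L(2)[OF that] B equi[of b z] z that by (metis imageI subsetD)
    then show "\<exists>L. compactin X L \<and> (\<forall>b\<in>B. \<phi> b (f z) \<in> L)"
      using image_compactin[OF L(1) cont] by blast
  qed
  then have "rel_compact_sets G X \<phi> (f z) = rel_compact_sets G Z \<psi> z" by blast
  then show "pointed_type G X \<phi> (f z) = pointed_type G Z \<psi> z"
    using pointed_type_eq_iff[OF assms(2,1) fz z] by simp
qed


section \<open>Minimal subsystems\<close>

text \<open>An action is a homomorphism into \<open>BijGroup E\<close>, whose elements are
  extensional on \<open>E\<close>; this accounts for \<open>ext\<close> and for the
  \<open>restrict\<close> in every action constructed below.\<close>

lemma group_actionI:
  fixes G (structure)
  assumes "group G"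
    and ext: "\<And>g. g \<in> carrier G \<Longrightarrow> \<phi> g \<in> extensional E"
    and closed: "\<And>g x. g \<in> carrier G \<Longrightarrow> x \<in> E \<Longrightarrow> \<phi> g x \<in> E"
    and one: "\<And>x. x \<in> E \<Longrightarrow> \<phi> \<one> x = x"
    and mult: "\<And>g h x. g \<in> carrier G \<Longrightarrow> h \<in> carrier G \<Longrightarrow> x \<in> E \<Longrightarrow> \<phi> (g \<otimes> h) x = \<phi> g (\<phi> h x)"
  shows "group_action G E \<phi>"
proof -
  interpret group G by fact
  have inv: "\<phi> (inv g) (\<phi> g x) = x" "\<phi> g (\<phi> (inv g) x) = x" if "g \<in> carrier G" "x \<in> E" for g x
    using that mult[of "inv g" g x] mult[of g "inv g" x] one by simp_all
  have Bij: "\<phi> g \<in> Bij E" if g: "g \<in> carrier G" for g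
  proof -
    have "bij_betw (\<phi> g) E E"
      using g inv closed by (intro bij_betw_byWitness[where f' = "\<phi> (inv g)"]) auto
    then show ?thesis using ext[OF g] by (simp add: Bij_def)
  qed
  have "\<phi> (g \<otimes> h) = compose E (\<phi> g) (\<phi> h)" if "g \<in> carrier G" "h \<in> carrier G" for g h
    using that ext mult by (intro extensionalityI[of _ E]) (auto simp: compose_def)
  then have "\<phi> \<in> hom G (BijGroup E)"
    using Bij by (auto simp: hom_def BijGroup_def)
  then show ?thesis
    by (intro group_action.intro group_hom.intro group_BijGroup group_hom_axioms.intro assms(1))
qed

lemma locally_compact_G_spaceI:
  fixes G (structure)
  assumes "group G" "locally_compact_space X" "Hausdorff_space X"
    and ext: "\<And>g. g \<in> carrier G \<Longrightarrow> \<phi> g \<in> extensional (topspace X)"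
    and cont: "\<And>g. g \<in> carrier G \<Longrightarrow> continuous_map X X (\<phi> g)"
    and one: "\<And>x. x \<in> topspace X \<Longrightarrow> \<phi> \<one> x = x"
    and mult: "\<And>g h x. g \<in> carrier G \<Longrightarrow> h \<in> carrier G \<Longrightarrow> x \<in> topspace X \<Longrightarrow>
      \<phi> (g \<otimes> h) x = \<phi> g (\<phi> h x)"
  shows "locally_compact_G_space G X \<phi>"
proof -
  interpret group G by fact
  have closed: "\<phi> g x \<in> topspace X" if "g \<in> carrier G" "x \<in> topspace X" for g x
    using continuous_map_image_subset_topspace[OF cont[OF that(1)]] that(2) by blast
  have "homeomorphic_map X X (\<phi> g)" if g: "g \<in> carrier G" for g
  proof -
    have "homeomorphic_maps X X (\<phi> g) (\<phi> (inv g))"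
      using g cont one mult[of "inv g" g] mult[of g "inv g"] by (simp add: homeomorphic_maps_def)
    then show ?thesis by (auto simp: homeomorphic_map_maps)
  qed
  moreover have "group_action G (topspace X) \<phi>"
    by (rule group_actionI[OF assms(1)]) (use ext closed one mult in auto)
  ultimately show ?thesis using assms by (simp add: locally_compact_G_space_def)
qed

lemma (in lc_G_space) locally_compact_G_space_subtopology:
  assumes M: "closedin X M" and inv: "\<And>g x. g \<in> carrier G \<Longrightarrow> x \<in> M \<Longrightarrow> \<phi> g x \<in> M"
  shows "locally_compact_G_space G (subtopology X M) (\<lambda>g. restrict (\<phi> g) M)"
proof (rule locally_compact_G_spaceI)
  have sub: "M \<subseteq> topspace X" using M closedin_subset by blast
  then have top: "topspace (subtopology X M) = M" by auto
  show "group G" ..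
  show "locally_compact_space (subtopology X M)"
    using lc_G_space M locally_compact_space_closed_subset
    by (auto simp: locally_compact_G_space_def)
  show "Hausdorff_space (subtopology X M)" using Hausdorff Hausdorff_space_subtopology by blast
  show "restrict (\<phi> g) M \<in> extensional (topspace (subtopology X M))" for g
    unfolding top by simp
  show "continuous_map (subtopology X M) (subtopology X M) (restrict (\<phi> g) M)"
    if g: "g \<in> carrier G" for g
  proof -
    have "continuous_map (subtopology X M) (subtopology X M) (\<phi> g)"
      by (rule continuous_map_into_subtopology[OF
            continuous_map_from_subtopology[OF act_continuous[OF g]]]) (use inv[OF g] top in auto)
    then show ?thesis by (rule continuous_map_eq) (use top in auto)
  qed
  show "restrict (\<phi> \<one>) M x = x" if "x \<in> topspace (subtopology X M)" for x
    using that act_one sub unfolding top by auto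
  show "restrict (\<phi> (g \<otimes> h)) M x = restrict (\<phi> g) M (restrict (\<phi> h) M x)"
    if "g \<in> carrier G" "h \<in> carrier G" "x \<in> topspace (subtopology X M)" for g h x
    using that inv sub composition_rule[of x g h] unfolding top by auto
qed

lemma (in lc_G_space) act_closure_of:
  assumes g: "g \<in> carrier G" and y: "y \<in> X closure_of S"
    and S: "\<And>s. s \<in> S \<Longrightarrow> \<phi> g s \<in> T"
  shows "\<phi> g y \<in> X closure_of T"
proof -
  have "\<phi> g y \<in> X closure_of (\<phi> g ` S)"
    using continuous_map_image_closure_subset[OF act_continuous[OF g]] y by blast
  then show ?thesis using closure_of_mono[of "\<phi> g ` S" T X] S by blast
qed

text \<open>Zorn is applied to the complements, the open invariant proper subsets, so that chains
  are bounded by unions. A maximal one has a minimal complement.\<close>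

lemma (in lc_G_space) minimal_subsystem:
  assumes ne: "topspace X \<noteq> {}" and K: "compactin X K"
    and cocompact: "\<And>x. x \<in> topspace X \<Longrightarrow> \<exists>g\<in>carrier G. \<phi> g x \<in> K"
  obtains M where "closedin X M"
    "minimal_G_space G (subtopology X M) (\<lambda>g. restrict (\<phi> g) M)"
proof -
  define \<A> where "\<A> = {U. openin X U \<and> (\<forall>g\<in>carrier G. \<forall>x\<in>U. \<phi> g x \<in> U) \<and> U \<noteq> topspace X}"
  have "{} \<in> \<A>" using ne[symmetric] unfolding \<A>_def by simp
  then have "\<exists>U\<in>\<A>. \<forall>V\<in>\<A>. U \<subseteq> V \<longrightarrow> V = U"
  proof (intro subset_Zorn_nonempty)
    fix \<C> assume \<C>: "\<C> \<noteq> {}" "subset.chain \<A> \<C>"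
    then have sub: "\<C> \<subseteq> \<A>" by (simp add: subset_chain_def)
    have "\<Union>\<C> \<noteq> topspace X"
    proof
      \<comment> \<open>By compactness a finite subchain covers \<open>K\<close>, and its union is
        one of its members. Every orbit enters \<open>K\<close>, so invariance makes that member the
        whole space, contrary to its being proper.\<close>
      assume "\<Union>\<C> = topspace X"
      then have "K \<subseteq> \<Union>\<C>" using compactin_subset_topspace[OF K] by simp
      moreover have "\<And>U. U \<in> \<C> \<Longrightarrow> openin X U" using sub by (auto simp: \<A>_def)
      ultimately obtain \<F> where \<F>: "finite \<F>" "\<F> \<subseteq> \<C>" "K \<subseteq> \<Union>\<F>"
        using compactinD[OF K, of \<C>] by blast
      have "K \<noteq> {}" using ne cocompact by blast
      then have "\<F> \<noteq> {}" using \<F>(3) by blast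
      moreover have "subset.chain \<A> \<F>" using \<C>(2) \<F>(2) unfolding subset_chain_def by (meson subset_trans subsetD)
      ultimately have "\<Union>\<F> \<in> \<A>" using Union_in_chain[OF \<F>(1)] \<F>(2) sub by blast
      then have inv: "\<And>g x. g \<in> carrier G \<Longrightarrow> x \<in> \<Union>\<F> \<Longrightarrow> \<phi> g x \<in> \<Union>\<F>"
        and proper: "\<Union>\<F> \<noteq> topspace X" "openin X (\<Union>\<F>)"
        unfolding \<A>_def by blast+
      have "x \<in> \<Union>\<F>" if x: "x \<in> topspace X" for x
      proof -
        obtain g where g: "g \<in> carrier G" "\<phi> g x \<in> K" using cocompact x by blast
        have "\<phi> (inv g) (\<phi> g x) \<in> \<Union>\<F>"
          by (rule inv[OF inv_closed[OF g(1)] subsetD[OF \<F>(3) g(2)]])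
        then show ?thesis using act_inv g x by simp
      qed
      then show False using proper openin_subset by blast
    qed
    then show "\<Union>\<C> \<in> \<A>" using sub unfolding \<A>_def by blast
  qed blast
  then obtain U where U_mem: "U \<in> \<A>" and max: "\<forall>V\<in>\<A>. U \<subseteq> V \<longrightarrow> V = U" ..
  have U: "openin X U" "\<And>g x. g \<in> carrier G \<Longrightarrow> x \<in> U \<Longrightarrow> \<phi> g x \<in> U"
      "U \<noteq> topspace X"
    using U_mem by (simp_all add: \<A>_def)
  define M where "M = topspace X - U"
  have M: "closedin X M" using U(1) unfolding M_def by (intro closedin_diff closedin_topspace)
  have U_sub: "U \<subseteq> topspace X" using U(1) openin_subset by blast
  have M_ne: "M \<noteq> {}" using U(3) U_sub by (auto simp: M_def)
  have M_sub: "M \<subseteq> topspace X" by (auto simp: M_def)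
  have M_inv: "\<phi> g x \<in> M" if g: "g \<in> carrier G" and x: "x \<in> M" for g x
  proof -
    have "\<phi> g x \<notin> U"
    proof
      assume "\<phi> g x \<in> U"
      then have "\<phi> (inv g) (\<phi> g x) \<in> U" using U(2) g by simp
      then show False using act_inv g x by (simp add: M_def)
    qed
    then show ?thesis using act_closed g x by (simp add: M_def)
  qed
  let ?\<psi> = "\<lambda>g. restrict (\<phi> g) M"
  have "dense_orbit G (subtopology X M) ?\<psi> x" if x: "x \<in> M" for x
  proof -
    have xX: "x \<in> topspace X" using x M_sub by blast
    let ?O = "orbit G \<phi> x" and ?C = "X closure_of (orbit G \<phi> x)"
    have orbit: "orbit G ?\<psi> x = ?O" using x by (simp add: orbit_def)
    have O_sub: "?O \<subseteq> M" using M_inv x by (auto simp: orbit_def)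
    have C_sub: "?C \<subseteq> M" using closure_of_minimal[OF O_sub M] .
    have x_C: "x \<in> ?C"
      using closure_of_subset[of ?O X] O_sub M_sub orbit_refl[OF xX] by blast
    have C_inv: "\<phi> g y \<in> ?C" if g: "g \<in> carrier G" and y: "y \<in> ?C" for g y
    proof (rule act_closure_of[OF g y])
      fix s assume "s \<in> ?O"
      then obtain h where h: "h \<in> carrier G" "s = \<phi> h x" by (auto simp: orbit_def)
      then have "\<phi> g s = \<phi> (g \<otimes> h) x" using composition_rule[OF xX g] by simp
      then show "\<phi> g s \<in> ?O" using g h by (auto simp: orbit_def)
    qed
    \<comment> \<open>The complement of the orbit closure is a member of \<open>\<A>\<close>
      containing \<open>U\<close>, so by maximality it equals \<open>U\<close>; hence the closure is
      all of \<open>M\<close>.\<close>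
    have "topspace X - ?C \<in> \<A>"
    proof -
      have "\<phi> g y \<in> topspace X - ?C" if g: "g \<in> carrier G" and y: "y \<in> topspace X - ?C" for g y
      proof -
        have "\<phi> g y \<notin> ?C"
        proof
          assume "\<phi> g y \<in> ?C"
          then have "\<phi> (inv g) (\<phi> g y) \<in> ?C" using C_inv g by simp
          then show False using act_inv g y by simp
        qed
        then show ?thesis using act_closed g y by simp
      qed
      moreover have "openin X (topspace X - ?C)" by (simp add: openin_diff)
      moreover have "topspace X - ?C \<noteq> topspace X" using x_C xX by blast
      ultimately show ?thesis unfolding \<A>_def by blast
    qed
    then have "topspace X - ?C = U" using max C_sub U_sub by (auto simp: M_def)
    then have "?C = M" using C_sub M_sub by (auto simp: M_def)
    moreover have "M \<inter> ?O = ?O" using O_sub by blast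
    ultimately show ?thesis
      using M_sub by (auto simp: dense_orbit_def orbit closure_of_subtopology)
  qed
  then have "minimal_G_space G (subtopology X M) ?\<psi>"
    unfolding minimal_G_space_def
    using locally_compact_G_space_subtopology[OF M M_inv] M_ne M_sub by auto
  then show thesis using that M by blast
qed

section \<open>Proper equivariant maps\<close>

lemma proper_G_map_subtopology:
  assumes f: "proper_G_map G Z \<psi> X \<phi> f" and M: "closedin Z M"
  shows "proper_G_map G (subtopology Z M) (\<lambda>g. restrict (\<psi> g) M) X \<phi> f"
proof -
  have "compactin (subtopology Z M) {z \<in> topspace (subtopology Z M). f z \<in> K}"
    if K: "compactin X K" for K
  proof -
    have "{z \<in> topspace (subtopology Z M). f z \<in> K} = M \<inter> {z \<in> topspace Z. f z \<in> K}" by auto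
    moreover have "compactin Z {z \<in> topspace Z. f z \<in> K}"
      using f K by (simp add: proper_G_map_def)
    ultimately show ?thesis
      using closed_Int_compactin[OF M] by (simp add: compactin_subtopology)
  qed
  then show ?thesis
    using f by (auto simp: proper_G_map_def continuous_map_from_subtopology)
qed

lemma proper_G_map_surj:
  assumes "locally_compact_G_space G Z \<psi>" "topspace Z \<noteq> {}" "minimal_G_space G X \<phi>"
    and f: "proper_G_map G Z \<psi> X \<phi> f"
  shows "f ` topspace Z = topspace X"
proof
  interpret X: minimal_space G X \<phi> by (rule minimal_spaceI) fact
  interpret Z: lc_G_space G Z \<psi> by unfold_locales fact
  have cont: "continuous_map Z X f"
    and proper: "\<And>K. compactin X K \<Longrightarrow> compactin Z {z \<in> topspace Z. f z \<in> K}"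
    and equi: "\<And>g z. g \<in> carrier G \<Longrightarrow> z \<in> topspace Z \<Longrightarrow> f (\<psi> g z) = \<phi> g (f z)"
    using f by (auto simp: proper_G_map_def)
  show sub: "f ` topspace Z \<subseteq> topspace X"
    using cont continuous_map_image_subset_topspace by blast
  show "topspace X \<subseteq> f ` topspace Z"
  proof (rule ccontr)
    assume "\<not> topspace X \<subseteq> f ` topspace Z"
    then obtain x where x: "x \<in> topspace X" "x \<notin> f ` topspace Z" by blast
    obtain U L where U: "openin X U" "x \<in> U" "U \<subseteq> L" and L: "compactin X L"
      using X.lc_G_space x(1)
      unfolding locally_compact_G_space_def locally_compact_space_def by blast
    \<comment> \<open>The part of the image lying in \<open>L\<close> is compact, hence closed, and
      misses \<open>x\<close>. The open set \<open>U - ?D\<close> around \<open>x\<close> contains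
      no image point, yet the orbit of any image point must meet it.\<close>
    let ?D = "f ` {z \<in> topspace Z. f z \<in> L}"
    have "closedin X ?D"
      using image_compactin[OF proper[OF L] cont] X.Hausdorff compactin_imp_closedin by blast
    then have "openin X (U - ?D)" using U(1) openin_diff by blast
    moreover have "U - ?D \<noteq> {}" using U(2) x(2) by blast
    moreover obtain z where z: "z \<in> topspace Z" using assms(2) by blast
    ultimately obtain g where g: "g \<in> carrier G" "\<phi> g (f z) \<in> U - ?D"
      using X.orbit_meets_open[of "f z" "U - ?D"] sub by blast
    then have "f (\<psi> g z) \<in> U - ?D" using equi z by simp
    then show False using U(3) Z.act_closed[OF g(1) z] by blast
  qed
qed

text \<open>Finitely many translates of one relatively compact open set cover \<open>L\<close>. This
  reduces properness of the projections to relatively compact open sets.\<close>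

lemma (in minimal_space) compact_subset_open:
  assumes L: "compactin X L"
  obtains U K where "openin X U" "L \<subseteq> U" "U \<subseteq> K" "compactin X K"
proof -
  obtain V C where V: "openin X V" "V \<noteq> {}" "V \<subseteq> C" and C: "compactin X C"
    by (rule compact_neighbourhood)
  obtain F where F: "finite F" "F \<subseteq> carrier G" "\<And>y. y \<in> L \<Longrightarrow> \<exists>f\<in>F. \<phi> f y \<in> V"
    using compact_cover[OF L V(1,2)] by metis
  let ?U = "\<Union>f\<in>F. {y \<in> topspace X. \<phi> f y \<in> V}" and ?K = "\<Union>f\<in>F. {y \<in> topspace X. \<phi> f y \<in> C}"
  have "openin X ?U" using F(2) openin_act_vimage V(1) by blast
  moreover have "compactin X ?K"
    using F(1,2) C by (intro compactin_Union) (auto intro: compactin_act_vimage)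
  moreover have "L \<subseteq> ?U" using F(3) compactin_subset_topspace[OF L] by blast
  moreover have "?U \<subseteq> ?K" using V(3) by blast
  ultimately show thesis using that[of ?U ?K] by blast
qed


section \<open>A common extension of spaces of equal type\<close>

text \<open>The extension is the union, over the sets \<open>B\<close> in the common family \<open>\<M>\<close> of relatively compact
  sets, of the closures of \<open>B.x\<close> in the product. This is locally compact with proper projections,
  although the product itself need not be locally compact: a point of the union whose \<open>i\<close>-th
  coordinate lies in a relatively compact open set \<open>U\<close> already lies in the closure of \<open>B.x\<close>, where
  \<open>B\<close> is the set of \<open>g\<close> with \<open>g.x\<^sub>i \<in> U\<close>.\<close>

locale equal_type_family =
  fixes G :: "('g, 'm) monoid_scheme" (structure) and I :: "'i set"
    and X :: "'i \<Rightarrow> 'x topology" and \<phi> :: "'i \<Rightarrow> 'g \<Rightarrow> 'x \<Rightarrow> 'x" and x :: "'i \<Rightarrow> 'x"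
    and \<M> :: "'g set set"
  assumes grp: "group G" and nonempty: "I \<noteq> {}"
    and minimal: "\<And>i. i \<in> I \<Longrightarrow> minimal_G_space G (X i) (\<phi> i)"
    and point: "\<And>i. i \<in> I \<Longrightarrow> x i \<in> topspace (X i)"
    and type: "\<And>i. i \<in> I \<Longrightarrow> rel_compact_sets G (X i) (\<phi> i) (x i) = \<M>"
begin

sublocale group G by (fact grp)

lemma space: "i \<in> I \<Longrightarrow> minimal_space G (X i) (\<phi> i)"
  using minimal by (rule minimal_spaceI)

lemma lc_space: "i \<in> I \<Longrightarrow> lc_G_space G (X i) (\<phi> i)"
  using space by (rule minimal_space.axioms(1))

abbreviation P where "P \<equiv> product_topology X I"

definition act where "act g z = (\<lambda>i\<in>I. \<phi> i g (z i))"

definition base_point where "base_point = restrict x I"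

definition piece where "piece B = P closure_of ((\<lambda>b. act b base_point) ` B)"

definition carrier_set where "carrier_set = (\<Union>B\<in>\<M>. piece B)"

abbreviation Z where "Z \<equiv> subtopology P carrier_set"

abbreviation \<psi> where "\<psi> \<equiv> \<lambda>g. restrict (act g) carrier_set"

lemma base_point: "base_point \<in> topspace P"
  using point by (auto simp: base_point_def)

lemma act_one: "z \<in> topspace P \<Longrightarrow> act \<one> z = z"
  using lc_G_space.act_one[OF lc_space]
  by (intro extensionalityI[of _ I]) (auto simp: act_def PiE_iff)

lemma act_mult:
  assumes "g \<in> carrier G" "h \<in> carrier G" "z \<in> topspace P"
  shows "act (g \<otimes> h) z = act g (act h z)"
proof (rule extensionalityI[of _ I])
  fix i assume i: "i \<in> I"
  interpret lc_G_space G "X i" "\<phi> i" using i by (rule lc_space)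
  show "act (g \<otimes> h) z i = act g (act h z) i"
    using i assms composition_rule[of "z i" g h] by (auto simp: act_def)
qed (auto simp: act_def)

lemma act_continuous:
  assumes "g \<in> carrier G"
  shows "continuous_map P P (act g)"
  unfolding continuous_map_componentwise
proof (intro conjI ballI)
  fix i assume i: "i \<in> I"
  have "continuous_map P (X i) (\<phi> i g \<circ> (\<lambda>z. z i))"
    using continuous_map_compose[OF continuous_map_product_projection[OF i]]
      lc_G_space.act_continuous[OF lc_space[OF i] assms] by blast
  then show "continuous_map P (X i) (\<lambda>z. act g z i)"
    using i by (simp add: act_def o_def)
qed (auto simp: act_def)

text \<open>Here the equality of types acts: \<open>\<M>\<close> is common to all indices, so a
  compact set found at one index yields compact sets at every other.\<close>

lemma mem_family_iff:
  "i \<in> I \<Longrightarrow> B \<in> \<M> \<longleftrightarrow> B \<subseteq> carrier G \<and> (\<exists>L. compactin (X i) L \<and> (\<forall>b\<in>B. \<phi> i b (x i) \<in> L))"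
  using lc_G_space.rel_compact_sets_iff[OF lc_space point] type by simp

lemma family_subset: "B \<in> \<M> \<Longrightarrow> B \<subseteq> carrier G"
  using mem_family_iff nonempty by blast

lemma family_translate:
  assumes "g \<in> carrier G" "B \<in> \<M>"
  shows "(\<lambda>b. g \<otimes> b) ` B \<in> \<M>"
proof -
  obtain i where i: "i \<in> I" using nonempty by blast
  interpret lc_G_space G "X i" "\<phi> i" using i by (rule lc_space)
  obtain L where B: "B \<subseteq> carrier G" and L: "compactin (X i) L" "\<And>b. b \<in> B \<Longrightarrow> \<phi> i b (x i) \<in> L"
    using assms(2) mem_family_iff[OF i] by auto
  have "compactin (X i) (\<phi> i g ` L)"
    using image_compactin[OF L(1) act_continuous[OF assms(1)]] .
  moreover have "\<phi> i (g \<otimes> b) (x i) \<in> \<phi> i g ` L" if b: "b \<in> B" for b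
  proof -
    have "b \<in> carrier G" using B b by blast
    then show ?thesis using composition_rule[OF point[OF i] assms(1)] L(2)[OF b] by simp
  qed
  moreover have "(\<lambda>b. g \<otimes> b) ` B \<subseteq> carrier G" using assms(1) B by auto
  ultimately show ?thesis
    unfolding mem_family_iff[OF i] by blast
qed

text \<open>Membership in \<open>\<M>\<close> makes the closure compact in each factor, and
  Tychonoff's theorem makes their product a compact set containing the piece.\<close>

lemma piece_compact:
  assumes B: "B \<in> \<M>"
  shows "compactin P (piece B)"
proof -
  let ?C = "\<lambda>i. X i closure_of ((\<lambda>b. \<phi> i b (x i)) ` B)"
  have "compactin (X i) (?C i)" if "i \<in> I" for i
    using B type[OF that] by (auto simp: rel_compact_sets_def)
  then have "compactin P (PiE I ?C)"
    by (simp add: compactin_PiE)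
  moreover have "piece B \<subseteq> PiE I ?C"
  proof
    fix z assume z: "z \<in> piece B"
    then have "z \<in> topspace P" unfolding piece_def by (rule subsetD[OF closure_of_subset_topspace])
    moreover have "z i \<in> ?C i" if i: "i \<in> I" for i
    proof -
      have "z i \<in> X i closure_of ((\<lambda>z. z i) ` (\<lambda>b. act b base_point) ` B)"
        using z unfolding piece_def
        by (intro subsetD[OF continuous_map_image_closure_subset[OF
                continuous_map_product_projection[OF i]]] imageI)
      moreover have "(\<lambda>z. z i) ` (\<lambda>b. act b base_point) ` B = (\<lambda>b. \<phi> i b (x i)) ` B"
        using i by (simp add: image_image act_def base_point_def)
      ultimately show ?thesis by simp
    qed
    ultimately show "z \<in> PiE I ?C" by (auto simp: PiE_iff)
  qed
  moreover have "closedin P (piece B)" by (simp add: piece_def)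
  ultimately show ?thesis by (rule closed_compactin)
qed

lemma carrier_set_subset: "carrier_set \<subseteq> topspace P"
  unfolding carrier_set_def piece_def using closure_of_subset_topspace[of P] by blast

lemma topspace_Z: "topspace Z = carrier_set"
  using carrier_set_subset by auto

lemma piece_compact_Z: "B \<in> \<M> \<Longrightarrow> compactin Z (piece B)"
  using piece_compact by (auto simp: compactin_subtopology carrier_set_def)

lemma act_carrier_set:
  assumes g: "g \<in> carrier G" and z: "z \<in> carrier_set"
  shows "act g z \<in> carrier_set"
proof -
  obtain B where B: "B \<in> \<M>" "z \<in> piece B" using z by (auto simp: carrier_set_def)
  have "act g z \<in> P closure_of (act g ` (\<lambda>b. act b base_point) ` B)"
    using continuous_map_image_closure_subset[OF act_continuous[OF g]] B(2)
    unfolding piece_def by blast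
  moreover have "act g ` (\<lambda>b. act b base_point) ` B = (\<lambda>b. act b base_point) ` (\<lambda>b. g \<otimes> b) ` B"
    using act_mult[OF g _ base_point] family_subset[OF B(1)]
    by (auto simp: image_image subset_iff intro!: image_cong)
  ultimately have "act g z \<in> piece ((\<lambda>b. g \<otimes> b) ` B)" by (simp add: piece_def)
  then show ?thesis using family_translate[OF g B(1)] by (auto simp: carrier_set_def)
qed

lemma base_point_carrier_set: "base_point \<in> carrier_set"
proof -
  obtain i where i: "i \<in> I" using nonempty by blast
  have "{\<one>} \<in> \<M>"
    unfolding mem_family_iff[OF i]
    using lc_G_space.act_one[OF lc_space point] i point
    by (auto intro!: exI[of _ "{x i}"])
  moreover have "base_point \<in> piece {\<one>}"
    unfolding piece_def using act_one[OF base_point] base_point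
    by (auto intro!: subsetD[OF closure_of_subset])
  ultimately show ?thesis by (auto simp: carrier_set_def)
qed

lemma vimage_subset_piece:
  assumes i: "i \<in> I" and U: "openin (X i) U" "U \<subseteq> L" and L: "compactin (X i) L"
  obtains B where "B \<in> \<M>" "{z \<in> carrier_set. z i \<in> U} \<subseteq> piece B"
proof -
  define B where "B = return_set G (\<phi> i) (x i) U"
  have "B \<in> \<M>"
    unfolding mem_family_iff[OF i] using U(2) L by (auto simp: B_def return_set_def)
  moreover have "{z \<in> carrier_set. z i \<in> U} \<subseteq> piece B"
  proof
    fix z assume "z \<in> {z \<in> carrier_set. z i \<in> U}"
    then obtain C where C: "C \<in> \<M>" "z \<in> piece C" and zU: "z i \<in> U"
      by (auto simp: carrier_set_def)
    have "z \<in> topspace P"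
      using C(2) unfolding piece_def by (rule subsetD[OF closure_of_subset_topspace])
    moreover have "\<exists>y. y \<in> (\<lambda>b. act b base_point) ` B \<and> y \<in> W"
      if W: "z \<in> W" "openin P W" for W
    proof -
      \<comment> \<open>Shrinking \<open>W\<close> by the condition at \<open>i\<close> forces the
        approximating elements of \<open>C\<close> to lie in \<open>B\<close>, so \<open>C\<close>
        can be exchanged for a set independent of \<open>z\<close>.\<close>
      let ?W = "W \<inter> {z \<in> topspace P. z i \<in> U}"
      have "openin P ?W"
        by (intro openin_Int W(2) openin_continuous_map_preimage[OF _ U(1)]
            continuous_map_product_projection i)
      moreover have "z \<in> ?W" using W(1) zU \<open>z \<in> topspace P\<close> by blast
      ultimately have "\<exists>y. y \<in> (\<lambda>b. act b base_point) ` C \<and> y \<in> ?W"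
        using C(2)[unfolded piece_def in_closure_of, THEN conjunct2, rule_format, of ?W] by simp
      then obtain c where c: "c \<in> C" "act c base_point \<in> ?W" by fast
      then have "\<phi> i c (x i) \<in> U" using i by (simp add: act_def base_point_def)
      then have "c \<in> B" using c(1) family_subset[OF C(1)] by (auto simp: B_def return_set_def)
      then show ?thesis using c(2) by blast
    qed
    ultimately show "z \<in> piece B" unfolding piece_def in_closure_of by blast
  qed
  ultimately show thesis using that by blast
qed

lemma projection_continuous: "i \<in> I \<Longrightarrow> continuous_map Z (X i) (\<lambda>z. z i)"
  by (intro continuous_map_from_subtopology continuous_map_product_projection)

lemma locally_compact_Z: "locally_compact_space Z"
  unfolding locally_compact_space_def topspace_Z
proof
  fix z assume z: "z \<in> carrier_set"
  obtain i where i: "i \<in> I" using nonempty by blast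
  interpret minimal_space G "X i" "\<phi> i" using i by (rule space)
  have zi: "z i \<in> topspace (X i)" using z i carrier_set_subset by auto
  obtain U L where U: "openin (X i) U" "z i \<in> U" "U \<subseteq> L" and L: "compactin (X i) L"
    using lc_G_space zi unfolding locally_compact_G_space_def locally_compact_space_def by blast
  obtain B where B: "B \<in> \<M>" "{z \<in> carrier_set. z i \<in> U} \<subseteq> piece B"
    using vimage_subset_piece[OF i U(1,3) L] .
  have "openin Z {z \<in> carrier_set. z i \<in> U}"
    using openin_continuous_map_preimage[OF projection_continuous[OF i] U(1)]
    unfolding topspace_Z .
  then show "\<exists>U K. openin Z U \<and> compactin Z K \<and> z \<in> U \<and> U \<subseteq> K"
    using piece_compact_Z[OF B(1)] B(2) z U(2) by blast
qed

lemma locally_compact_G_space_Z: "locally_compact_G_space G Z \<psi>"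
proof (rule locally_compact_G_spaceI)
  show "group G" "locally_compact_space Z" by (fact grp, fact locally_compact_Z)
  have "Hausdorff_space P"
    using lc_G_space.Hausdorff[OF lc_space] by (simp add: Hausdorff_space_product_topology)
  then show "Hausdorff_space Z" by (rule Hausdorff_space_subtopology)
  show "\<psi> g \<in> extensional (topspace Z)" for g unfolding topspace_Z by simp
  show "continuous_map Z Z (\<psi> g)" if g: "g \<in> carrier G" for g
  proof -
    have "continuous_map Z Z (act g)"
      by (rule continuous_map_into_subtopology[OF
            continuous_map_from_subtopology[OF act_continuous[OF g]]])
        (use act_carrier_set[OF g] topspace_Z in auto)
    then show ?thesis by (rule continuous_map_eq) (use topspace_Z in auto)
  qed
  show "\<psi> \<one> z = z" if "z \<in> topspace Z" for z
    using that act_one carrier_set_subset unfolding topspace_Z by auto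
  show "\<psi> (g \<otimes> h) z = \<psi> g (\<psi> h z)"
    if "g \<in> carrier G" "h \<in> carrier G" "z \<in> topspace Z" for g h z
    using that act_mult[of g h z] act_carrier_set carrier_set_subset unfolding topspace_Z by auto
qed

lemma proper_G_map_projection:
  assumes i: "i \<in> I"
  shows "proper_G_map G Z \<psi> (X i) (\<phi> i) (\<lambda>z. z i)"
  unfolding proper_G_map_def topspace_Z
proof (intro conjI allI impI ballI)
  show "continuous_map Z (X i) (\<lambda>z. z i)" using i by (rule projection_continuous)
  interpret minimal_space G "X i" "\<phi> i" using i by (rule space)
  show "compactin Z {z \<in> carrier_set. z i \<in> K}" if K: "compactin (X i) K" for K
  proof -
    obtain U L where U: "openin (X i) U" "K \<subseteq> U" "U \<subseteq> L" and L: "compactin (X i) L"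
      using compact_subset_open[OF K] .
    obtain B where B: "B \<in> \<M>" "{z \<in> carrier_set. z i \<in> U} \<subseteq> piece B"
      using vimage_subset_piece[OF i U(1,3) L] .
    have "closedin Z {z \<in> carrier_set. z i \<in> K}"
      using closedin_continuous_map_preimage[OF projection_continuous[OF i]
          compactin_imp_closedin[OF Hausdorff K]]
      unfolding topspace_Z .
    moreover have "{z \<in> carrier_set. z i \<in> K} \<subseteq> piece B" using B(2) U(2) by blast
    ultimately show ?thesis using closed_compactin[OF piece_compact_Z[OF B(1)]] by blast
  qed
  show "\<psi> g z i = \<phi> i g (z i)" if "g \<in> carrier G" "z \<in> carrier_set" for g z
    using that i by (simp add: act_def)
qed

text \<open>The preimage of \<open>K\<close> under one proper projection is compact and meets every
  orbit, since the orbits below meet \<open>U\<close>. This co-compactness is what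
  \<open>minimal_subsystem\<close> requires.\<close>

lemma common_minimal_extension:
  obtains Y \<tau> where "minimal_G_space G (Y :: ('i \<Rightarrow> 'x) topology) \<tau>"
    "\<forall>i\<in>I. proper_G_map G Y \<tau> (X i) (\<phi> i) (\<lambda>z. z i)"
proof -
  interpret Z: lc_G_space G Z \<psi> by unfold_locales (rule locally_compact_G_space_Z)
  obtain i where i: "i \<in> I" using nonempty by blast
  interpret X: minimal_space G "X i" "\<phi> i" using i by (rule space)
  obtain U K where U: "openin (X i) U" "U \<noteq> {}" "U \<subseteq> K" and K: "compactin (X i) K"
    by (rule X.compact_neighbourhood)
  let ?K = "{z \<in> topspace Z. z i \<in> K}"
  have K': "compactin Z ?K"
    using proper_G_map_projection[OF i] K by (simp add: proper_G_map_def)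
  have cocompact: "\<exists>g\<in>carrier G. \<psi> g z \<in> ?K" if z: "z \<in> topspace Z" for z
  proof -
    have "z i \<in> topspace (X i)" using z i by auto
    then obtain g where g: "g \<in> carrier G" "\<phi> i g (z i) \<in> U"
      using X.orbit_meets_open U by blast
    moreover have "\<psi> g z i = \<phi> i g (z i)" using z i unfolding topspace_Z by (simp add: act_def)
    ultimately have "\<psi> g z \<in> ?K" using Z.act_closed[OF g(1) z] U(3) by auto
    then show ?thesis using g(1) by blast
  qed
  have ne: "topspace Z \<noteq> {}" using base_point_carrier_set unfolding topspace_Z by blast
  obtain M where M: "closedin Z M"
    and min: "minimal_G_space G (subtopology Z M) (\<lambda>g. restrict (\<psi> g) M)"
    by (rule Z.minimal_subsystem[OF ne K' cocompact])
  show thesis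
    by (rule that[OF min]) (use proper_G_map_subtopology[OF proper_G_map_projection M] in auto)
qed

end

section \<open>The equivalence of the three conditions\<close>

lemma minimal_G_space_singleton:
  fixes G (structure)
  assumes "group G"
  shows "minimal_G_space G (discrete_topology {a}) (\<lambda>g. restrict id {a})"
proof -
  interpret group G by fact
  have "locally_compact_G_space G (discrete_topology {a}) (\<lambda>g. restrict id {a})"
    by (rule locally_compact_G_spaceI[OF assms locally_compact_space_discrete_topology])
      simp_all
  moreover have "orbit G (\<lambda>g. restrict id {a}) a = {a}"
    by (auto simp: orbit_def)
  moreover have "discrete_topology {a} closure_of {a} = {a}"
    by (subst closure_of_eq) simp
  ultimately show ?thesis
    unfolding minimal_G_space_def dense_orbit_def topspace_discrete_topology by simp
qed

lemma proper_G_map_imp_space_type_eq: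
  assumes "countable (carrier G)" and Z: "minimal_G_space G Z \<psi>" and X: "minimal_G_space G X \<phi>"
    and f: "proper_G_map G Z \<psi> X \<phi> f"
  shows "space_type G X \<phi> = space_type G Z \<psi>"
proof -
  obtain z where z: "z \<in> topspace Z" using Z unfolding minimal_G_space_def by blast
  show ?thesis
    using proper_G_map_imp_pointed_type_eq[OF Z X f z]
    by (intro space_type_cong[OF assms(1) X Z _ z])
qed

(* HOL cannot quantify existentially over types, so the space Z of (ii) is handled as follows:
   the first conjunct produces Z on the type 'i => 'x of the product of the X i, and the last one
   derives (i) from a space Z on an arbitrary type 'z (without assuming the maps surjective). *)
theorem corollary9p15:
  fixes G :: "('g, 'm) monoid_scheme"
    and I :: "'i set"
    and X :: "'i \<Rightarrow> 'x topology"
    and \<phi> :: "'i \<Rightarrow> 'g \<Rightarrow> 'x \<Rightarrow> 'x"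
  assumes "group G" and "countable (carrier G)" and "infinite (carrier G)"
    and "\<And>i. i \<in> I \<Longrightarrow> minimal_G_space G (X i) (\<phi> i)"
  shows
    "((\<forall>i \<in> I. \<forall>j \<in> I. space_type G (X i) (\<phi> i) = space_type G (X j) (\<phi> j))
      \<longleftrightarrow> (\<exists>(Z :: ('i \<Rightarrow> 'x) topology) \<psi>. minimal_G_space G Z \<psi> \<and>
            (\<forall>i \<in> I. \<exists>f. proper_G_map G Z \<psi> (X i) (\<phi> i) f \<and> f ` topspace Z = topspace (X i))))
     \<and>
     ((\<forall>i \<in> I. \<forall>j \<in> I. space_type G (X i) (\<phi> i) = space_type G (X j) (\<phi> j))
      \<longleftrightarrow> (\<exists>x. (\<forall>i \<in> I. x i \<in> topspace (X i)) \<and>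
            (\<forall>i \<in> I. \<forall>j \<in> I. pointed_type G (X i) (\<phi> i) (x i) = pointed_type G (X j) (\<phi> j) (x j))))
     \<and>
     (\<forall>(Z :: 'z topology) \<psi>. minimal_G_space G Z \<psi> \<and>
            (\<forall>i \<in> I. \<exists>f. proper_G_map G Z \<psi> (X i) (\<phi> i) f)
      \<longrightarrow> (\<forall>i \<in> I. \<forall>j \<in> I. space_type G (X i) (\<phi> i) = space_type G (X j) (\<phi> j)))"
    (is "(?i \<longleftrightarrow> ?ii) \<and> (?i \<longleftrightarrow> ?iii) \<and> ?iv")
proof -
  note minimal = assms(4)
  have iii_imp_i: ?i if ?iii
    using that space_type_cong[OF assms(2) minimal minimal] by metis
  have i_imp_iii: ?iii if i: ?i
  proof (cases "I = {}")
    case False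
    \<comment> \<open>One index and one point serve as reference; every other space is given a point
      matching the type of this one.\<close>
    then obtain j where j: "j \<in> I" by blast
    obtain y where y: "y \<in> topspace (X j)" using minimal[OF j] unfolding minimal_G_space_def by blast
    have "\<exists>x. x \<in> topspace (X k) \<and>
        pointed_type G (X k) (\<phi> k) x = pointed_type G (X j) (\<phi> j) y" if k: "k \<in> I" for k
    proof -
      have "space_type G (X k) (\<phi> k) = space_type G (X j) (\<phi> j)" using i j k by blast
      then show ?thesis
        using space_type_eq_imp_pointed_type_eq[OF assms(2) minimal[OF k] minimal[OF j] y]
        by metis
    qed
    then obtain x where "\<And>k. k \<in> I \<Longrightarrow> x k \<in> topspace (X k) \<and>
        pointed_type G (X k) (\<phi> k) (x k) = pointed_type G (X j) (\<phi> j) y"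
      by metis
    then show ?thesis by (intro exI[of _ x]) simp
  qed auto
  have iii_imp_ii: ?ii if iii: ?iii
  proof (cases "I = {}")
    case True
    \<comment> \<open>The empty family imposes no maps, but a minimal space still has to be
      exhibited; a single fixed point serves.\<close>
    then show ?thesis
      using minimal_G_space_singleton[OF assms(1)]
      by (intro exI[of _ "discrete_topology {undefined}"]
          exI[of _ "\<lambda>g. restrict id {undefined}"]) simp
  next
    case False
    then obtain j where j: "j \<in> I" by blast
    obtain x where x: "\<And>i. i \<in> I \<Longrightarrow> x i \<in> topspace (X i)"
      and type: "\<And>i. i \<in> I \<Longrightarrow>
        pointed_type G (X i) (\<phi> i) (x i) = pointed_type G (X j) (\<phi> j) (x j)"
      using iii j by blast
    interpret equal_type_family G I X \<phi> x "rel_compact_sets G (X j) (\<phi> j) (x j)"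
    proof (rule equal_type_family.intro)
      show "rel_compact_sets G (X i) (\<phi> i) (x i) = rel_compact_sets G (X j) (\<phi> j) (x j)"
        if "i \<in> I" for i
        using pointed_type_eq_iff[OF minimal minimal x x] that j type by blast
    qed (use assms(1) False minimal x in auto)
    obtain Y :: "('i \<Rightarrow> 'x) topology" and \<tau> where Y: "minimal_G_space G Y \<tau>"
      and proper: "\<forall>i\<in>I. proper_G_map G Y \<tau> (X i) (\<phi> i) (\<lambda>z. z i)"
      by (rule common_minimal_extension)
    have "(\<lambda>z. z i) ` topspace Y = topspace (X i)" if "i \<in> I" for i
      using proper_G_map_surj[OF _ _ minimal[OF that] bspec[OF proper that]] Y
      by (simp add: minimal_G_space_def)
    then show ?thesis using Y proper by blast
  qed
  note extension = proper_G_map_imp_space_type_eq[OF assms(2) _ minimal]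
  have ii_imp_i: ?i if ?ii
    using that extension by metis
  have ?iv
    using extension by metis
  then show ?thesis using iii_imp_i i_imp_iii iii_imp_ii ii_imp_i by blast
qed

end
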